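(* Fix $c>1$ and let $d=d(n)=\omega(\log n)$. Consider any (randomized) cell-probe data structure with $m$ cells of $o(\log n)$ bits each that, for every query, reads at most two cells, and solves the decision ANN problem for the Hamming random instance with probability at least $2/3$. Then $m\ge n^{\left(\frac{c}{c-1}\right)^2-o(1)}$.
   Context: Hamming random instance: the dataset $P$ consists of $n$ independent uniformly random points of $\{-1,1\}^d$; a query $q$ is generated by choosing a uniformly random $p\in P$ and flipping each coordinate of $p$ independently with probability $\frac{1}{2c}$ (so with high probability $q$ is within Hamming distance $r=(1+o(1))\frac d{2c}$ of $p$ and at distance more than $cr$ from all other data points). Decision ANN: each data point $p\in P$ carries a bit $x_p\in\{0,1\}$ (part of the input to preprocessing); given a query $q$ within distance $r$ of a data point $p$ such that all points of $P\setminus\{p\}$ are at distance more than $cr$ from $q$, the data structure must output $x_p$ with probability at least $2/3$. In the cell-probe model only the number of cells read by the query is counted.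
   Formalization: The gap factor c is replaced by any c'(n)→c, and r~d/(2c) is any sequence for which the stated promise (q within r of p, farther than c'r from all other points) holds with probability 1-o(1); this is assumed, since with exactly c it cannot hold. *)

theory Defs
  imports "HOL-Probability.Probability" "HOL-Library.Landau_Symbols"
begin

section \<open>The Hamming random instance\<close>

definition hamming_cube :: "nat \<Rightarrow> int list set" where
  "hamming_cube d = {v. length v = d \<and> set v \<subseteq> {-1, 1}}"

definition hamming_dist :: "int list \<Rightarrow> int list \<Rightarrow> nat" where
  "hamming_dist u v = card {k. k < length u \<and> u ! k \<noteq> v ! k}"

definition flip_coords :: "real \<Rightarrow> int list \<Rightarrow> int list pmf" where
  "flip_coords \<delta> v = do {
     flips \<leftarrow> replicate_pmf (length v) (bernoulli_pmf \<delta>);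
     return_pmf (map2 (\<lambda>b a. if b then - a else a) flips v)}"

text \<open>
  A sample \<open>(P, i, q)\<close> consists of the dataset, the index of the data point from which the query
  was generated, and the query.  Datasets are lists, so that coinciding data points keep
  separate indices.
\<close>

definition hamming_random_instance ::
    "real \<Rightarrow> nat \<Rightarrow> nat \<Rightarrow> (int list list \<times> nat \<times> int list) pmf" where
  "hamming_random_instance c n d = do {
     P \<leftarrow> replicate_pmf n (pmf_of_set (hamming_cube d));
     i \<leftarrow> pmf_of_set {..<n};
     q \<leftarrow> flip_coords (1 / (2 * c)) (P ! i);
     return_pmf (P, i, q)}"


section \<open>Decision approximate near neighbour search\<close>

definition unique_near_neighbour ::
    "real \<Rightarrow> real \<Rightarrow> int list list \<Rightarrow> int list \<Rightarrow> nat \<Rightarrow> bool" where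
  "unique_near_neighbour r c P q i \<longleftrightarrow>
     i < length P \<and> real (hamming_dist (P ! i) q) \<le> r \<and>
     (\<forall>j<length P. j \<noteq> i \<longrightarrow> real (hamming_dist (P ! j) q) > c * r)"

text \<open>
  The bit \<open>x ! i\<close> belongs to the data point \<open>P ! i\<close>.  If the promise fails, every answer is
  accepted.
\<close>

definition decision_ann_correct ::
    "real \<Rightarrow> real \<Rightarrow> int list list \<Rightarrow> bool list \<Rightarrow> int list \<Rightarrow> bool \<Rightarrow> bool" where
  "decision_ann_correct r c P x q answer \<longleftrightarrow>
     (\<forall>i. unique_near_neighbour r c P q i \<longrightarrow> answer = x ! i)"


section \<open>Cell-probe data structures\<close>

type_synonym cell = "bool list"
type_synonym table = "nat \<Rightarrow> cell"

text \<open>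
  A query algorithm is a decision tree: the next cell to read may depend arbitrarily on the
  contents of the cells read before, and computation between reads is free.
\<close>

datatype cell_probe_alg = Answer bool | Probe nat "cell \<Rightarrow> cell_probe_alg"

primrec run_alg :: "cell_probe_alg \<Rightarrow> table \<Rightarrow> bool" where
  "run_alg (Answer b) T = b"
| "run_alg (Probe a k) T = run_alg (k (T a)) T"

primrec cells_read :: "cell_probe_alg \<Rightarrow> table \<Rightarrow> nat set" where
  "cells_read (Answer b) T = {}"
| "cells_read (Probe a k) T = insert a (cells_read (k (T a)) T)"

text \<open>Preprocessing of the points and their bits into a table, and the query algorithm.\<close>

type_synonym data_structure =
  "(int list list \<Rightarrow> bool list \<Rightarrow> table) \<times> (int list \<Rightarrow> cell_probe_alg)"

definition cell_probe_data_structure ::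
    "nat \<Rightarrow> nat \<Rightarrow> nat \<Rightarrow> nat \<Rightarrow> nat \<Rightarrow> data_structure \<Rightarrow> bool" where
  "cell_probe_data_structure n d m w t D \<longleftrightarrow>
     (\<forall>P x. length P = n \<and> set P \<subseteq> hamming_cube d \<and> length x = n \<longrightarrow>
        (\<forall>a<m. length (fst D P x a) = w) \<and>
        (\<forall>q\<in>hamming_cube d.
           cells_read (snd D q) (fst D P x) \<subseteq> {..<m} \<and>
           card (cells_read (snd D q) (fst D P x)) \<le> t))"

text \<open>
  A randomized data structure is a distribution over deterministic ones, so that preprocessing
  and queries may share randomness free of charge.
\<close>

definition randomized_cell_probe_data_structure ::
    "nat \<Rightarrow> nat \<Rightarrow> nat \<Rightarrow> nat \<Rightarrow> nat \<Rightarrow> data_structure pmf \<Rightarrow> bool" where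
  "randomized_cell_probe_data_structure n d m w t \<D> \<longleftrightarrow>
     (\<forall>D\<in>set_pmf \<D>. cell_probe_data_structure n d m w t D)"

text \<open>
  The noise parameter \<open>c0\<close> of the random instance is kept apart from the approximation factor
  \<open>c\<close> of the search problem, since the two can agree only asymptotically: if \<open>r\<close> is at least the
  typical distance \<open>d / (2 * c0)\<close> from the query to its near neighbour, then \<open>c0 * r \<ge> d / 2\<close>, and
  about half of the other data points or more lie within distance \<open>c0 * r\<close> of the query.
\<close>

definition solves_decision_ann_on_random_instance ::
    "real \<Rightarrow> real \<Rightarrow> real \<Rightarrow> nat \<Rightarrow> nat \<Rightarrow> real \<Rightarrow> data_structure pmf \<Rightarrow> bool" where
  "solves_decision_ann_on_random_instance c0 r c n d prob_success \<D> \<longleftrightarrow>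
     (\<forall>x. length x = n \<longrightarrow>
        measure_pmf.prob (pair_pmf \<D> (hamming_random_instance c0 n d))
          {(D, P, i, q). decision_ann_correct r c P x q (run_alg (snd D q) (fst D P x))}
        \<ge> prob_success)"

end

theory Submission
  imports Defs "HOL-Real_Asymp.Real_Asymp"
begin

text \<open>
  Guessing the contents of the two cells turns a data structure into bilinear forms in the table,
  so its advantage is at most \<open>4 ^ w = n powr o(1)\<close> times the largest correlation of the bits
  \<open>x\<^sub>i\<close> with products \<open>Y\<^sub>u Y\<^sub>v\<close>, where the query determines the two cells \<open>u, v\<close>.
  For fixed data points this correlation is \<open>y\<^sup>T (\<Sum>\<^sub>i x\<^sub>i M\<^sub>i) y\<close>, and a trace moment computation
  (as for the non-commutative Khintchine inequality) bounds the norm of a random signed sum of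
  matrices, provided that no single data point accounts for more than a factor \<open>\<kappa> = n powr (1 - \<eta>)\<close>
  over the average of the probes of a cell.  Hypercontractivity of the noise operator with
  correlation \<open>\<tau> = 1 - 1 / c\<close> shows that a cell probed by a fraction \<open>\<mu>\<close> of all queries violates this
  only on a negligible part of its probes as long as \<open>\<mu> powr (- \<tau>\<^sup>2) < \<kappa>\<close>, that is, for tables
  with fewer than \<open>n powr (1 / \<tau>\<^sup>2)\<close> cells.
\<close>

section \<open>Hypercontractivity on the cube\<close>

text \<open>The table may depend arbitrarily on both the data points and the bits, so the vector
  \<open>y\<close> is correlated with the signs, and concentration for a fixed vector says nothing.
  A bound uniform in \<open>y\<close> is needed, hence an operator norm; two probes are exactly what
  makes the correlation quadratic in \<open>y\<close>. For typical data points this norm is of order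
  \<open>sqrt (n * \<kappa>)\<close>, against the trivial bound n, so every \<kappa> below n by a
  power of n suffices. As the dimension in the trace and in union bounds the number of cells costs
  only a polynomial factor, which a large constant moment or an exponentially small tail absorbs. It
  limits the exponent through \<mu>, which is about 1 / m for an average cell. The obstacle is a
  cell shaped like a ball around a data point, which receives nearly all queries of that point. Such
  probes are cut out one by one, for each pair of cell and data point, instead of discarding whole
  cells or points; hypercontractivity bounds the mass lost in this way.\<close>

lemma gbinomial_Suc_right:
  fixes a :: real
  shows "a gchoose Suc k = (a gchoose k) * (a - real k) / real (Suc k)"
proof -
  have "real (Suc k) * (a gchoose Suc k) = (a - real k) * (a gchoose k)"
    using gbinomial_absorption[of k a] gbinomial_absorb_comp[of a k] by simp
  thus ?thesis by (simp add: field_simps del: of_nat_Suc)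
qed

text \<open>At order two the condition on \<tau> makes both sides equal. From an even order
  \<open>l\<close> to the next, the coefficient is multiplied by \<open>F a\<close>, which is
  nonnegative and decreasing in \<open>a\<close> for \<open>a \<le> 2 \<le> l\<close>, while the
  extra factor \<open>\<tau>\<^sup>2\<close> is at most 1.\<close>

lemma gbinomial_even_mono:
  fixes p q \<tau> :: real
  assumes "1 < p" "p \<le> q" "q \<le> 2" "\<tau>\<^sup>2 * (q - 1) = p - 1" "\<tau>\<^sup>2 \<le> 1"
  shows "0 \<le> p / q * ((q gchoose (2 * Suc k)) * \<tau> ^ (2 * Suc k)) \<and>
         p / q * ((q gchoose (2 * Suc k)) * \<tau> ^ (2 * Suc k)) \<le> p gchoose (2 * Suc k)"
proof (induction k)
  case 0
  have q: "q gchoose 2 = q * (q - 1) / 2" for q :: real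
    by (simp add: numeral_2_eq_2 gbinomial_Suc_right)
  have "p / q * ((q gchoose 2) * \<tau>\<^sup>2) = p * (\<tau>\<^sup>2 * (q - 1)) / 2"
    using assms by (simp add: q field_simps)
  also have "\<dots> = p gchoose 2" by (simp add: assms q)
  finally have "p / q * ((q gchoose 2) * \<tau>\<^sup>2) = p gchoose 2" .
  moreover have "0 \<le> p gchoose 2" using assms by (simp add: q)
  ultimately show ?case by (simp only: mult_Suc_right mult_0_right add_0_right) simp
next
  case (Suc k)
  define l where "l = 2 * Suc k"
  define F where "F = (\<lambda>a::real. (real l - a) * (real l + 1 - a) / (real (Suc l) * real (Suc (Suc l))))"
  have l2: "real l \<ge> 2" by (simp add: l_def)
  have step: "a gchoose (Suc (Suc l)) = (a gchoose l) * F a" for a :: real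
    by (simp add: gbinomial_Suc_right F_def) (simp add: field_simps)
  have F: "0 \<le> F q" "F q \<le> F p"
    using assms l2 unfolding F_def
    by (auto intro!: divide_right_mono mult_mono)
  have *: "p / q * ((q gchoose Suc (Suc l)) * \<tau> ^ Suc (Suc l))
      = (p / q * ((q gchoose l) * \<tau> ^ l)) * (F q * \<tau>\<^sup>2)"
    by (simp add: step power2_eq_square)
  have IH: "0 \<le> p / q * ((q gchoose l) * \<tau> ^ l)" "p / q * ((q gchoose l) * \<tau> ^ l) \<le> p gchoose l"
    using Suc by (simp_all only: l_def)
  have "F q * \<tau>\<^sup>2 \<le> F p * 1" using F assms by (intro mult_mono) auto
  hence "(p / q * ((q gchoose l) * \<tau> ^ l)) * (F q * \<tau>\<^sup>2) \<le> (p gchoose l) * (F p * 1)"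
    using IH F by - (rule mult_mono, auto)
  moreover have "0 \<le> (p / q * ((q gchoose l) * \<tau> ^ l)) * (F q * \<tau>\<^sup>2)"
    using IH F by - (rule mult_nonneg_nonneg, auto)
  moreover have l: "2 * Suc (Suc k) = Suc (Suc l)" by (simp add: l_def)
  ultimately show ?case unfolding l * unfolding step by (simp only: mult_1_right)
qed

text \<open>Averaging over b and -b cancels the odd powers, and the comparison of the even binomial
  coefficients yields \<open>Eq - 1 \<le> q / p * (Ep - 1)\<close>. Bernoulli's inequality
  \<open>1 + q / p * (Ep - 1) \<le> Ep powr (q / p)\<close> finishes the proof.\<close>

lemma two_point_symmetric:
  fixes p q \<tau> b :: real
  assumes p: "1 < p" and pq: "p < q" and q: "q \<le> 2" and \<tau>: "\<tau>\<^sup>2 * (q - 1) = p - 1"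
    and b: "\<bar>b\<bar> < 1"
  shows "((1 + \<tau> * b) powr q + (1 - \<tau> * b) powr q) / 2
    \<le> (((1 + b) powr p + (1 - b) powr p) / 2) powr (q / p)"
proof -
  have \<tau>1: "\<tau>\<^sup>2 \<le> 1"
  proof (rule ccontr)
    assume "\<not> ?thesis"
    hence "1 * (q - 1) \<le> \<tau>\<^sup>2 * (q - 1)" using p pq by (intro mult_right_mono) auto
    thus False using \<tau> pq by simp
  qed
  hence "\<bar>\<tau>\<bar> \<le> 1" by (simp add: abs_square_le_1)
  hence "\<bar>\<tau>\<bar> * \<bar>b\<bar> \<le> 1 * \<bar>b\<bar>" by (intro mult_right_mono) auto
  hence \<tau>b: "\<bar>\<tau> * b\<bar> < 1" using b by (simp add: abs_mult)
  have series: "(\<lambda>n. (a gchoose n) * (z ^ n + (- z) ^ n)) sums ((1 + z) powr a + (1 - z) powr a)"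
    if "\<bar>z\<bar> < 1" for a z :: real
    using sums_add[OF gen_binomial_real[of z a] gen_binomial_real[of "- z" a]] that
    by (simp add: distrib_left)
  define t where "t n = (p gchoose n) * (b ^ n + (- b) ^ n)
    - p / q * ((q gchoose n) * ((\<tau> * b) ^ n + (- (\<tau> * b)) ^ n))" for n
  define Ep where "Ep = ((1 + b) powr p + (1 - b) powr p) / 2"
  define Eq where "Eq = ((1 + \<tau> * b) powr q + (1 - \<tau> * b) powr q) / 2"
  have half: "2 * (z / 2) = z" for z :: real by simp
  have sums: "t sums (2 * Ep - p / q * (2 * Eq))"
    using sums_diff[OF series[OF b, of p] sums_mult[OF series[OF \<tau>b, of q], of "p / q"]]
    by (simp only: t_def[abs_def] Ep_def Eq_def half)
  have nonneg: "0 \<le> t n" if "n \<noteq> 0" for n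
  proof (cases "even n")
    case False
    thus ?thesis by (simp add: t_def)
  next
    case True
    with that obtain k where k: "n = 2 * Suc k"
      by (metis evenE mult_0_right not0_implies_Suc)
    have "t n = 2 * b ^ n * ((p gchoose n) - p / q * ((q gchoose n) * \<tau> ^ n))"
      using True by (simp add: t_def power_mult_distrib algebra_simps)
    moreover have "p / q * ((q gchoose n) * \<tau> ^ n) \<le> p gchoose n"
      using gbinomial_even_mono[of p q \<tau> k] p pq q \<tau> \<tau>1 unfolding k by simp
    moreover have "0 \<le> b ^ n" using True by (rule zero_le_even_power)
    ultimately show ?thesis by simp
  qed
  have "t 0 \<le> 2 * Ep - p / q * (2 * Eq)"
    using sum_le_suminf[of t "{0}"] nonneg sums by (simp add: sums_iff)
  hence "p / q * Eq \<le> Ep - 1 + p / q" by (simp add: t_def)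
  hence "q / p * (p / q * Eq) \<le> q / p * (Ep - 1 + p / q)"
    using p pq by (intro mult_left_mono) auto
  hence Eq: "Eq \<le> q / p * (Ep - 1 + p / q)"
    using p pq by simp
  have Ep0: "0 \<le> Ep" by (simp add: Ep_def)
  \<comment> \<open>Young's inequality with second factor 1 is Bernoulli's inequality for the
    exponent \<open>q / p\<close>.\<close>
  have "Ep * 1 \<le> Ep powr (q / p) / (q / p) + 1 powr (q / (q - p)) / (q / (q - p))"
    using p pq Ep0 by (intro Youngs_inequality) (auto simp: field_simps)
  moreover have "1 / (q / (q - p)) = 1 - p / q" "1 / (q / p) = p / q" using p pq by (auto simp: field_simps)
  ultimately have "Ep - 1 + p / q \<le> Ep powr (q / p) * (p / q)"
    by simp
  hence "q / p * (Ep - 1 + p / q) \<le> q / p * (Ep powr (q / p) * (p / q))"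
    using p pq by (intro mult_left_mono) auto
  hence "q / p * (Ep - 1 + p / q) \<le> Ep powr (q / p)"
    using p pq by simp
  with Eq have "Eq \<le> Ep powr (q / p)" by (rule order_trans)
  thus ?thesis by (simp only: Ep_def Eq_def)
qed

text \<open>By homogeneity two positive values can be written \<open>a * (1 + b)\<close> and
  \<open>a * (1 - b)\<close> with \<open>\<bar>b\<bar> < 1\<close>, the range in which the binomial
  series converge. A vanishing value is reached by continuity.\<close>

lemma two_point_hypercontractive:
  fixes p q \<tau> x y :: real
  assumes p: "1 < p" and pq: "p < q" and q: "q \<le> 2" and \<tau>: "\<tau>\<^sup>2 * (q - 1) = p - 1"
    and \<tau>1: "\<bar>\<tau>\<bar> \<le> 1" and "0 \<le> x" "0 \<le> y"
  shows "(((1 + \<tau>) / 2 * x + (1 - \<tau>) / 2 * y) powr q + ((1 - \<tau>) / 2 * x + (1 + \<tau>) / 2 * y) powr q) / 2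
    \<le> ((x powr p + y powr p) / 2) powr (q / p)" (is "?L x y \<le> ?R x y")
proof -
  have pos: "?L x y \<le> ?R x y" if xy: "0 < x" "0 < y" for x y
  proof -
    define a b where "a = (x + y) / 2" and "b = (x - y) / (x + y)"
    have a: "a > 0" using xy by (simp add: a_def)
    have b: "\<bar>b\<bar> < 1" using xy by (simp add: b_def abs_less_iff field_simps)
    have "2 * a = x + y" by (simp add: a_def)
    hence "b = (x - y) / (2 * a)" by (simp only: b_def)
    hence ab: "a * b = (x - y) / 2" using a by simp
    have x: "x = a * (1 + b)" and y: "y = a * (1 - b)"
      by (simp_all add: distrib_left right_diff_distrib ab) (simp_all add: a_def field_simps)
    have 1: "(1 + \<tau>) / 2 * x + (1 - \<tau>) / 2 * y = a * (1 + \<tau> * b)"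
      and 2: "(1 - \<tau>) / 2 * x + (1 + \<tau>) / 2 * y = a * (1 - \<tau> * b)"
      unfolding x y by (simp_all add: field_simps)
    have "?L x y = a powr q * (((1 + \<tau> * b) powr q + (1 - \<tau> * b) powr q) / 2)"
      unfolding 1 2 powr_mult by (simp add: distrib_left)
    also have "\<dots> \<le> a powr q * (((1 + b) powr p + (1 - b) powr p) / 2) powr (q / p)"
      by (intro mult_left_mono two_point_symmetric p pq q \<tau> b) auto
    also have "a powr q = (a powr p) powr (q / p)" using p by (simp add: powr_powr)
    also have "\<dots> * (((1 + b) powr p + (1 - b) powr p) / 2) powr (q / p)
      = (a powr p * (((1 + b) powr p + (1 - b) powr p) / 2)) powr (q / p)"
      by (simp only: powr_mult)
    also have "a powr p * (((1 + b) powr p + (1 - b) powr p) / 2) = (x powr p + y powr p) / 2"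
      unfolding x y powr_mult by (simp add: distrib_left)
    finally show ?thesis .
  qed
  have lim: "(\<lambda>n. x + 1 / real (Suc n)) \<longlonglongrightarrow> x" for x :: real
    using LIMSEQ_inverse_real_of_nat_add[of x] by (simp add: inverse_eq_divide)
  have le1: "0 \<le> 1 + \<tau>" "0 \<le> 1 - \<tau>" using \<tau>1 by auto
  show ?thesis
  proof (rule LIMSEQ_le)
    show "(\<lambda>n. ?L (x + 1 / real (Suc n)) (y + 1 / real (Suc n))) \<longlonglongrightarrow> ?L x y"
      using p pq assms le1
      by (intro tendsto_intros lim) (auto intro!: always_eventually add_nonneg_nonneg mult_nonneg_nonneg)
    show "(\<lambda>n. ?R (x + 1 / real (Suc n)) (y + 1 / real (Suc n))) \<longlonglongrightarrow> ?R x y"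
      using p pq assms
      by (intro tendsto_intros lim) (auto intro!: always_eventually add_nonneg_nonneg divide_nonneg_nonneg)
    show "\<exists>N. \<forall>n\<ge>N. ?L (x + 1 / real (Suc n)) (y + 1 / real (Suc n))
        \<le> ?R (x + 1 / real (Suc n)) (y + 1 / real (Suc n))"
      using assms by (intro exI[of _ 0] allI impI pos) (auto intro: add_nonneg_pos)
  qed
qed

lemma two_point_Holder:
  fixes r s x1 x2 y1 y2 :: real
  assumes r: "1 < r" and s: "1 < s" and rs: "1 / r + 1 / s = 1"
    and nn: "0 \<le> x1" "0 \<le> x2" "0 \<le> y1" "0 \<le> y2"
  shows "(x1 * y1 + x2 * y2) / 2
    \<le> ((x1 powr r + x2 powr r) / 2) powr (1 / r) * ((y1 powr s + y2 powr s) / 2) powr (1 / s)"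
proof -
  define X Y where "X = ((x1 powr r + x2 powr r) / 2) powr (1 / r)"
    and "Y = ((y1 powr s + y2 powr s) / 2) powr (1 / s)"
  have Xr: "X powr r = (x1 powr r + x2 powr r) / 2" and Ys: "Y powr s = (y1 powr s + y2 powr s) / 2"
    using r s by (simp_all add: X_def Y_def powr_powr)
  show ?thesis
  proof (cases "X = 0 \<or> Y = 0")
    case True
    hence "x1 powr r + x2 powr r = 0 \<or> y1 powr s + y2 powr s = 0" using Xr Ys by auto
    hence "(x1 = 0 \<and> x2 = 0) \<or> (y1 = 0 \<and> y2 = 0)"
      by (metis add_nonneg_eq_0_iff powr_eq_0_iff powr_ge_zero)
    thus ?thesis by auto
  next
    case False
    hence XY: "X > 0" "Y > 0" by (auto simp: X_def Y_def)
    have young: "x / X * (y / Y) \<le> x powr r / X powr r / r + y powr s / Y powr s / s"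
      if "0 \<le> x" "0 \<le> y" for x y
      using Youngs_inequality[OF r s rs, of "x / X" "y / Y"] that XY by (simp add: powr_divide)
    have "(x1 * y1 + x2 * y2) / 2 / (X * Y) = (x1 / X * (y1 / Y) + x2 / X * (y2 / Y)) / 2"
      using XY by (simp add: field_simps)
    also have "\<dots> \<le> ((x1 powr r / X powr r / r + y1 powr s / Y powr s / s)
        + (x2 powr r / X powr r / r + y2 powr s / Y powr s / s)) / 2"
      using nn by (intro divide_right_mono add_mono young) auto
    also have "\<dots> = ((x1 powr r + x2 powr r) / 2) / X powr r / r + ((y1 powr s + y2 powr s) / 2) / Y powr s / s"
      by (simp add: add_divide_distrib)
    also have "\<dots> = 1 / r + 1 / s"
      using XY by (simp add: Xr[symmetric] Ys[symmetric])
    finally have "(x1 * y1 + x2 * y2) / 2 / (X * Y) \<le> 1" using rs by simp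
    thus ?thesis using XY by (simp add: X_def[symmetric] Y_def[symmetric] field_simps)
  qed
qed

text \<open>The dual form, by Hoelder with the exponent \<open>r\<close> conjugate to
  \<open>q\<close>. A bilinear estimate by a product of two norms passes to product spaces by a
  plain induction, with no need for Minkowski's inequality.\<close>

lemma two_point_bilinear:
  fixes p q r \<tau> x1 x2 y1 y2 :: real
  assumes p: "1 < p" and pq: "p < q" and q: "q \<le> 2" and \<tau>: "\<tau>\<^sup>2 * (q - 1) = p - 1"
    and \<tau>1: "\<bar>\<tau>\<bar> \<le> 1" and r: "1 / r + 1 / q = 1"
    and nn: "0 \<le> x1" "0 \<le> x2" "0 \<le> y1" "0 \<le> y2"
  shows "((1 + \<tau>) / 2 * (x1 * y1 + x2 * y2) + (1 - \<tau>) / 2 * (x1 * y2 + x2 * y1)) / 2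
    \<le> ((x1 powr r + x2 powr r) / 2) powr (1 / r) * ((y1 powr p + y2 powr p) / 2) powr (1 / p)"
proof -
  define z1 z2 where "z1 = (1 + \<tau>) / 2 * y1 + (1 - \<tau>) / 2 * y2"
    and "z2 = (1 - \<tau>) / 2 * y1 + (1 + \<tau>) / 2 * y2"
  have le1: "0 \<le> 1 + \<tau>" "0 \<le> 1 - \<tau>" using \<tau>1 by auto
  have z: "0 \<le> z1" "0 \<le> z2" using le1 nn by (auto simp: z1_def z2_def)
  have "1 / r = 1 - 1 / q" using r by simp
  hence "1 / r = (q - 1) / q" using p pq by (simp add: field_simps)
  hence "r = q / (q - 1)" by (metis divide_divide_eq_right div_by_1 inverse_divide inverse_eq_divide)
  moreover have "q - 1 < q" "0 < q - 1" using p pq by auto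
  ultimately have r1: "1 < r" by (simp only: less_divide_eq_1_pos)
  have "((1 + \<tau>) / 2 * (x1 * y1 + x2 * y2) + (1 - \<tau>) / 2 * (x1 * y2 + x2 * y1)) / 2
    = (x1 * z1 + x2 * z2) / 2"
    by (simp add: z1_def z2_def field_simps)
  also have "\<dots> \<le> ((x1 powr r + x2 powr r) / 2) powr (1 / r) * ((z1 powr q + z2 powr q) / 2) powr (1 / q)"
    using two_point_Holder[OF r1 _ r] p pq nn z by simp
  also have "\<dots> \<le> ((x1 powr r + x2 powr r) / 2) powr (1 / r)
      * (((y1 powr p + y2 powr p) / 2) powr (q / p)) powr (1 / q)"
    using two_point_hypercontractive[OF p pq q \<tau> \<tau>1 nn(3,4)] p pq
    by (intro mult_left_mono powr_mono2) (auto simp: z1_def z2_def)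
  also have "(((y1 powr p + y2 powr p) / 2) powr (q / p)) powr (1 / q)
      = ((y1 powr p + y2 powr p) / 2) powr (1 / p)"
    using p pq by (simp add: powr_powr)
  finally show ?thesis .
qed

section \<open>Random signed sums of matrices\<close>

text \<open>Matrices are functions of two indices from an explicit finite set, whose size varies.\<close>

primrec mat_pow :: "'v set \<Rightarrow> ('v \<Rightarrow> 'v \<Rightarrow> real) \<Rightarrow> nat \<Rightarrow> 'v \<Rightarrow> 'v \<Rightarrow> real" where
  "mat_pow V S 0 = (\<lambda>u v. if u = v then 1 else 0)"
| "mat_pow V S (Suc L) = (\<lambda>u v. \<Sum>w\<in>V. S u w * mat_pow V S L w v)"

lemma mat_pow_add:
  assumes "finite V" "u \<in> V"
  shows "mat_pow V S (a + b) u v = (\<Sum>w\<in>V. mat_pow V S a u w * mat_pow V S b w v)"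
  using assms(2)
proof (induction a arbitrary: u)
  case 0
  thus ?case using assms(1) by (simp add: if_distrib if_distribR cong: if_cong)
next
  case (Suc a)
  have "mat_pow V S (Suc a + b) u v = (\<Sum>w\<in>V. S u w * (\<Sum>t\<in>V. mat_pow V S a w t * mat_pow V S b t v))"
    using Suc by simp
  also have "\<dots> = (\<Sum>t\<in>V. \<Sum>w\<in>V. S u w * (mat_pow V S a w t * mat_pow V S b t v))"
    by (subst sum.swap) (simp add: sum_distrib_left)
  finally show ?case by (simp add: sum_distrib_right mult.assoc)
qed

lemma mat_pow_1: "finite V \<Longrightarrow> v \<in> V \<Longrightarrow> mat_pow V S 1 u v = S u v"
  by (simp add: if_distrib cong: if_cong)

lemma mat_pow_sym:
  assumes "finite V" "\<And>u v. u \<in> V \<Longrightarrow> v \<in> V \<Longrightarrow> S u v = S v u" "u \<in> V" "v \<in> V"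
  shows "mat_pow V S L u v = mat_pow V S L v u"
  using assms(3,4)
proof (induction L arbitrary: u v)
  case 0
  thus ?case by simp
next
  case (Suc L)
  have "mat_pow V S (Suc L) v u = mat_pow V S (L + 1) v u" by simp
  also have "\<dots> = (\<Sum>w\<in>V. mat_pow V S L v w * mat_pow V S 1 w u)"
    using assms(1) Suc.prems by (subst mat_pow_add) auto
  also have "\<dots> = (\<Sum>w\<in>V. S u w * mat_pow V S L w v)"
  proof (rule sum.cong)
    fix w assume "w \<in> V"
    thus "mat_pow V S L v w * mat_pow V S 1 w u = S u w * mat_pow V S L w v"
      using Suc assms mat_pow_1[of V u S w] by simp
  qed simp
  finally show ?case by simp
qed

section \<open>Quadratic forms bounded by traces of matrix powers\<close>

definition quad_form :: "'v set \<Rightarrow> ('v \<Rightarrow> 'v \<Rightarrow> real) \<Rightarrow> ('v \<Rightarrow> real) \<Rightarrow> real" where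
  "quad_form V S y = (\<Sum>u\<in>V. \<Sum>v\<in>V. y u * S u v * y v)"

context
  fixes V :: "'v set" and S :: "'v \<Rightarrow> 'v \<Rightarrow> real" and y :: "'v \<Rightarrow> real"
  assumes V: "finite V" and sym: "\<And>u v. u \<in> V \<Longrightarrow> v \<in> V \<Longrightarrow> S u v = S v u"
begin

lemma quad_form_double:
  "quad_form V (mat_pow V S (2 * L)) y = (\<Sum>w\<in>V. (\<Sum>v\<in>V. mat_pow V S L w v * y v)\<^sup>2)"
proof -
  have "quad_form V (mat_pow V S (2 * L)) y
    = (\<Sum>u\<in>V. \<Sum>v\<in>V. y u * (\<Sum>w\<in>V. mat_pow V S L w u * mat_pow V S L w v) * y v)"
    unfolding quad_form_def mult_2
    by (intro sum.cong refl arg_cong2[of _ _ _ _ "(*)"])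
      (auto simp: mat_pow_add[OF V] mat_pow_sym[OF V sym] intro!: sum.cong)
  also have "\<dots> = (\<Sum>u\<in>V. \<Sum>v\<in>V. \<Sum>w\<in>V. (mat_pow V S L w u * y u) * (mat_pow V S L w v * y v))"
    by (simp add: sum_distrib_left sum_distrib_right mult_ac)
  also have "\<dots> = (\<Sum>w\<in>V. \<Sum>u\<in>V. \<Sum>v\<in>V. (mat_pow V S L w u * y u) * (mat_pow V S L w v * y v))"
    by (subst (2) sum.swap, subst sum.swap) simp
  finally show ?thesis by (simp add: power2_eq_square sum_product)
qed

lemma quad_form_square_le:
  "(quad_form V (mat_pow V S L) y)\<^sup>2 \<le> (\<Sum>u\<in>V. (y u)\<^sup>2) * quad_form V (mat_pow V S (2 * L)) y"
proof -
  have "quad_form V (mat_pow V S L) y = (\<Sum>u\<in>V. y u * (\<Sum>v\<in>V. mat_pow V S L u v * y v))"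
    by (simp add: quad_form_def sum_distrib_left mult.assoc)
  thus ?thesis
    using Cauchy_Schwarz_ineq_sum[of y "\<lambda>u. \<Sum>v\<in>V. mat_pow V S L u v * y v" V]
    by (simp add: quad_form_double)
qed

lemma trace_double:
  "(\<Sum>u\<in>V. mat_pow V S (2 * L) u u) = (\<Sum>u\<in>V. \<Sum>v\<in>V. (mat_pow V S L u v)\<^sup>2)"
  unfolding mult_2 power2_eq_square
  by (intro sum.cong refl) (auto simp: mat_pow_add[OF V] mat_pow_sym[OF V sym] intro!: sum.cong)

lemma quad_form_le_trace:
  "quad_form V (mat_pow V S (2 * L)) y
    \<le> (\<Sum>u\<in>V. (y u)\<^sup>2) * (\<Sum>u\<in>V. mat_pow V S (2 * L) u u)"
proof -
  have "quad_form V (mat_pow V S (2 * L)) y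
    \<le> (\<Sum>w\<in>V. (\<Sum>v\<in>V. (mat_pow V S L w v)\<^sup>2) * (\<Sum>v\<in>V. (y v)\<^sup>2))"
    unfolding quad_form_double by (intro sum_mono Cauchy_Schwarz_ineq_sum)
  thus ?thesis by (subst mult.commute) (simp only: trace_double sum_distrib_right)
qed

text \<open>Replaces the spectral theorem: repeated Cauchy-Schwarz passes from \<open>S\<close> to
  its powers, doubling the exponent each time, and the last even power is bounded by its trace, a
  squared Frobenius norm. This is why the moments are powers of two.\<close>

lemma quad_form_power_le_trace:
  "\<bar>quad_form V S y\<bar> ^ (2 ^ Suc h)
    \<le> (\<Sum>u\<in>V. (y u)\<^sup>2) ^ (2 ^ Suc h) * (\<Sum>u\<in>V. mat_pow V S (2 ^ Suc h) u u)"
proof -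
  define Y where "Y = (\<Sum>u\<in>V. (y u)\<^sup>2)"
  define Q where "Q L = quad_form V (mat_pow V S L) y" for L
  have Q1: "quad_form V S y = Q 1"
    unfolding Q_def quad_form_def by (intro sum.cong refl) (simp only: mat_pow_1[OF V])
  have tr: "0 \<le> (\<Sum>u\<in>V. mat_pow V S (2 ^ Suc h) u u)"
    by (simp only: power_Suc trace_double) (simp add: sum_nonneg)
  have "Y \<ge> 0" by (simp add: Y_def sum_nonneg)
  then consider "Y = 0" | "Y > 0" by linarith
  thus ?thesis
  proof cases
    case 1
    hence "\<And>u. u \<in> V \<Longrightarrow> y u = 0"
      using V by (simp add: Y_def sum_nonneg_eq_0_iff)
    hence "quad_form V S y = 0" by (simp add: quad_form_def)
    moreover have "(0::real) ^ (2 ^ Suc h) = 0" by simp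
    moreover have "0 \<le> (\<Sum>u\<in>V. (y u)\<^sup>2) ^ (2 ^ Suc h) * (\<Sum>u\<in>V. mat_pow V S (2 ^ Suc h) u u)"
      using tr by (intro mult_nonneg_nonneg zero_le_power) (auto intro: sum_nonneg)
    ultimately show ?thesis by (simp only: abs_zero)
  next
    case 2
    \<comment> \<open>The additional factor \<open>Y\<close> on the left avoids the exponent
      \<open>2 ^ j - 1\<close> on the right; it is cancelled at the end, as
      \<open>Y > 0\<close>.\<close>
    have "Y * \<bar>Q 1\<bar> ^ (2 ^ j) \<le> Y ^ (2 ^ j) * \<bar>Q (2 ^ j)\<bar>" for j
    proof (induction j)
      case 0
      thus ?case by simp
    next
      case (Suc j)
      have pw: "z ^ (2 ^ Suc j) = (z ^ (2 ^ j))\<^sup>2" for z :: real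
        by (simp add: power_mult[symmetric] mult.commute)
      have "Y * (Y * \<bar>Q 1\<bar> ^ (2 ^ Suc j)) = (Y * \<bar>Q 1\<bar> ^ (2 ^ j))\<^sup>2"
        by (simp only: pw power_mult_distrib) (simp add: power2_eq_square)
      also have "\<dots> \<le> (Y ^ (2 ^ j) * \<bar>Q (2 ^ j)\<bar>)\<^sup>2"
        using Suc 2 by (intro power_mono) auto
      also have "\<dots> = Y ^ (2 ^ Suc j) * (Q (2 ^ j))\<^sup>2"
        by (simp only: pw power_mult_distrib power2_abs)
      also have "\<dots> \<le> Y ^ (2 ^ Suc j) * (Y * Q (2 ^ Suc j))"
        using 2 quad_form_square_le by (intro mult_left_mono) (auto simp: Q_def Y_def)
      also have "\<dots> \<le> Y * (Y ^ (2 ^ Suc j) * \<bar>Q (2 ^ Suc j)\<bar>)"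
        using 2 by (simp add: mult.left_commute mult_left_mono)
      finally show ?case using 2 by simp
    qed
    from this[of "Suc h"] have "Y * \<bar>Q 1\<bar> ^ (2 ^ Suc h) \<le> Y ^ (2 ^ Suc h) * \<bar>Q (2 ^ Suc h)\<bar>" .
    also have "\<bar>Q (2 ^ Suc h)\<bar> = Q (2 ^ Suc h)"
      unfolding Q_def power_Suc quad_form_double by (simp add: sum_nonneg)
    also have "Y ^ (2 ^ Suc h) * \<dots> \<le> Y ^ (2 ^ Suc h) * (Y * (\<Sum>u\<in>V. mat_pow V S (2 ^ Suc h) u u))"
      using 2 unfolding Q_def Y_def power_Suc by (intro mult_left_mono quad_form_le_trace) auto
    finally have "Y * \<bar>Q 1\<bar> ^ (2 ^ Suc h)
        \<le> Y * (Y ^ (2 ^ Suc h) * (\<Sum>u\<in>V. mat_pow V S (2 ^ Suc h) u u))"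
      by (simp only: mult_ac)
    thus ?thesis using 2 unfolding Q1 Y_def[symmetric] by simp
  qed
qed

end

section \<open>Moments of quadratic forms with random sign coefficients\<close>

locale random_signs =
  fixes X :: "'x set" and \<epsilon> :: "'x \<Rightarrow> nat \<Rightarrow> real" and n :: nat
  assumes finite_X: "finite X" and X_nonempty: "X \<noteq> {}"
    and sign_square: "\<And>x i. x \<in> X \<Longrightarrow> i < n \<Longrightarrow> \<epsilon> x i * \<epsilon> x i = 1"
    and orthogonal: "\<And>A. A \<subseteq> {..<n} \<Longrightarrow> A \<noteq> {} \<Longrightarrow> (\<Sum>x\<in>X. \<Prod>i\<in>A. \<epsilon> x i) = 0"
begin

definition ave :: "('x \<Rightarrow> real) \<Rightarrow> real" where
  "ave f = (\<Sum>x\<in>X. f x) / real (card X)"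

lemma card_X: "0 < real (card X)"
  using finite_X X_nonempty by (simp add: card_gt_0_iff)

lemma ave_sum: "ave (\<lambda>x. \<Sum>j\<in>J. f j x) = (\<Sum>j\<in>J. ave (f j))"
  unfolding ave_def by (subst sum.swap) (simp add: sum_divide_distrib)

lemma ave_cmult: "ave (\<lambda>x. a * f x) = a * ave f"
  by (simp add: ave_def sum_distrib_left)

lemma ave_const: "ave (\<lambda>x. a) = a"
  using card_X by (simp add: ave_def)

lemma ave_mono: "(\<And>x. x \<in> X \<Longrightarrow> f x \<le> g x) \<Longrightarrow> ave f \<le> ave g"
  unfolding ave_def by (intro divide_right_mono sum_mono) auto

lemma ave_cong: "(\<And>x. x \<in> X \<Longrightarrow> f x = g x) \<Longrightarrow> ave f = ave g"
  unfolding ave_def by (intro arg_cong2[of _ _ _ _ "(/)"] sum.cong) auto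

lemma ave_add: "ave (\<lambda>x. f x + g x) = ave f + ave g"
  by (simp add: ave_def sum.distrib add_divide_distrib)

text \<open>The Walsh characters. Only the empty one has nonzero mean, which selects the walks that
  use every sign an even number of times.\<close>

definition chi :: "nat set \<Rightarrow> 'x \<Rightarrow> real" where
  "chi A x = (\<Prod>i\<in>A. \<epsilon> x i)"

text \<open>Symmetric difference with the singleton of \<open>i\<close>: as signs square to 1,
  multiplication by the sign of index \<open>i\<close> acts on characters in this way.\<close>

definition flip :: "nat set \<Rightarrow> nat \<Rightarrow> nat set" where
  "flip A i = (if i \<in> A then A - {i} else insert i A)"

lemma chi_mult:
  assumes "x \<in> X" "i < n" "finite A"
  shows "chi A x * \<epsilon> x i = chi (flip A i) x"
proof (cases "i \<in> A")
  case True
  hence "chi A x = \<epsilon> x i * chi (A - {i}) x"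
    using assms(3) by (simp add: chi_def prod.remove)
  thus ?thesis using True sign_square[OF assms(1,2)] by (simp add: flip_def mult.commute mult.left_commute)
next
  case False
  thus ?thesis using assms by (simp add: chi_def flip_def mult.commute)
qed

lemma ave_chi: "A \<subseteq> {..<n} \<Longrightarrow> ave (chi A) = (if A = {} then 1 else 0)"
  using card_X orthogonal[of A] by (auto simp: ave_def chi_def)

text \<open>
  Expanding \<open>S\<^sup>L\<close> as a sum over walks, every factor \<open>\<epsilon> i\<close> either cancels an element of the current
  set \<open>A\<close>, of which there are at most \<open>Lm\<close>, or enlarges \<open>A\<close>; as the walk has to end with the
  empty set, steps of the second kind are at most as frequent as those of the first kind, up to
  the initial size of \<open>A\<close>.  The potential \<open>\<beta> ^ card A\<close> balances the two costs.
\<close>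

lemma walk_sum_bound:
  fixes M :: "nat \<Rightarrow> 'v \<Rightarrow> 'v \<Rightarrow> real" and \<omega> :: "'v \<Rightarrow> real"
  defines "S x \<equiv> (\<lambda>u v. \<Sum>i<n. \<epsilon> x i * M i u v)"
  assumes V: "finite V" and \<omega>: "\<And>u. u \<in> V \<Longrightarrow> 0 < \<omega> u"
    and row: "\<And>i u. i < n \<Longrightarrow> u \<in> V \<Longrightarrow> (\<Sum>v\<in>V. \<bar>M i u v\<bar> * \<omega> v) \<le> \<kappa> * \<omega> u"
    and total: "\<And>u. u \<in> V \<Longrightarrow> (\<Sum>i<n. \<Sum>v\<in>V. \<bar>M i u v\<bar> * \<omega> v) \<le> N * \<omega> u"
    and \<alpha>: "0 < \<alpha>" "0 < \<beta>" "0 \<le> \<kappa>" "N * \<beta> \<le> \<alpha>" "real Lm * \<kappa> \<le> \<alpha> * \<beta>"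
    and A: "A \<subseteq> {..<n}" "card A + L \<le> Lm" and u: "u \<in> V"
  shows "(\<Sum>v\<in>V. \<bar>ave (\<lambda>x. chi A x * mat_pow V (S x) L u v)\<bar> * \<omega> v)
    \<le> \<omega> u * (2 * \<alpha>) ^ L * \<beta> ^ card A"
  using A u
proof (induction L arbitrary: A u)
  case 0
  have "(\<Sum>v\<in>V. \<bar>ave (\<lambda>x. chi A x * mat_pow V (S x) 0 u v)\<bar> * \<omega> v)
    = (\<Sum>v\<in>V. if u = v then \<bar>ave (chi A)\<bar> * \<omega> u else 0)"
    by (intro sum.cong refl) (auto simp: ave_const ave_def)
  also have "\<dots> = \<bar>ave (chi A)\<bar> * \<omega> u" using V 0 by simp
  also have "\<dots> \<le> \<omega> u * \<beta> ^ card A"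
    using \<omega>[of u] \<alpha> 0 by (auto simp: ave_chi)
  finally show ?case by simp
next
  case (Suc L)
  have finA: "finite A" using Suc.prems(1) finite_subset by blast
  define r where "r i = (\<Sum>w\<in>V. \<bar>M i u w\<bar> * \<omega> w)" for i
  have r: "0 \<le> r i" for i using \<omega> by (auto simp: r_def less_imp_le intro!: sum_nonneg mult_nonneg_nonneg)
  \<comment> \<open>A step adds at most one element to \<open>A\<close> and shortens the remaining
    walk by one, which preserves the invariant.\<close>
  have flip: "flip A i \<subseteq> {..<n}" "card (flip A i) + L \<le> Lm" if "i < n" for i
    using Suc.prems that finA by (auto simp: flip_def card_insert_if)
  have expand: "ave (\<lambda>x. chi A x * mat_pow V (S x) (Suc L) u v)
    = (\<Sum>i<n. \<Sum>w\<in>V. M i u w * ave (\<lambda>x. chi (flip A i) x * mat_pow V (S x) L w v))" for v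
  proof -
    have "ave (\<lambda>x. chi A x * mat_pow V (S x) (Suc L) u v)
      = ave (\<lambda>x. \<Sum>i<n. \<Sum>w\<in>V. M i u w * (chi (flip A i) x * mat_pow V (S x) L w v))"
    proof (rule ave_cong)
      fix x assume x: "x \<in> X"
      have "chi A x * mat_pow V (S x) (Suc L) u v
        = (\<Sum>w\<in>V. \<Sum>i<n. M i u w * ((chi A x * \<epsilon> x i) * mat_pow V (S x) L w v))"
        by (simp add: S_def sum_distrib_left sum_distrib_right mult_ac)
      also have "\<dots> = (\<Sum>w\<in>V. \<Sum>i<n. M i u w * (chi (flip A i) x * mat_pow V (S x) L w v))"
        using x finA by (intro sum.cong refl) (simp add: chi_mult)
      finally show "chi A x * mat_pow V (S x) (Suc L) u v
        = (\<Sum>i<n. \<Sum>w\<in>V. M i u w * (chi (flip A i) x * mat_pow V (S x) L w v))"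
        by (subst sum.swap)
    qed
    thus ?thesis by (simp add: ave_sum ave_cmult)
  qed
  have "(\<Sum>v\<in>V. \<bar>ave (\<lambda>x. chi A x * mat_pow V (S x) (Suc L) u v)\<bar> * \<omega> v)
    \<le> (\<Sum>v\<in>V. (\<Sum>i<n. \<Sum>w\<in>V. \<bar>M i u w\<bar> * \<bar>ave (\<lambda>x. chi (flip A i) x * mat_pow V (S x) L w v)\<bar>) * \<omega> v)"
  proof (intro sum_mono mult_right_mono)
    fix v assume v: "v \<in> V"
    show "\<bar>ave (\<lambda>x. chi A x * mat_pow V (S x) (Suc L) u v)\<bar>
      \<le> (\<Sum>i<n. \<Sum>w\<in>V. \<bar>M i u w\<bar> * \<bar>ave (\<lambda>x. chi (flip A i) x * mat_pow V (S x) L w v)\<bar>)"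
      unfolding expand abs_mult[symmetric]
      by (rule order_trans[OF sum_abs]) (intro sum_mono sum_abs)
    show "0 \<le> \<omega> v" using \<omega>[OF v] by simp
  qed
  also have "\<dots> = (\<Sum>v\<in>V. \<Sum>i<n. \<Sum>w\<in>V. \<bar>M i u w\<bar> * (\<bar>ave (\<lambda>x. chi (flip A i) x * mat_pow V (S x) L w v)\<bar> * \<omega> v))"
    by (simp add: sum_distrib_right mult.assoc)
  also have "\<dots> = (\<Sum>i<n. \<Sum>w\<in>V. \<Sum>v\<in>V. \<bar>M i u w\<bar> * (\<bar>ave (\<lambda>x. chi (flip A i) x * mat_pow V (S x) L w v)\<bar> * \<omega> v))"
    by (subst sum.swap, subst (2) sum.swap) simp
  also have "\<dots> = (\<Sum>i<n. \<Sum>w\<in>V. \<bar>M i u w\<bar> * (\<Sum>v\<in>V. \<bar>ave (\<lambda>x. chi (flip A i) x * mat_pow V (S x) L w v)\<bar> * \<omega> v))"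
    by (simp add: sum_distrib_left)
  also have "\<dots> \<le> (\<Sum>i<n. \<Sum>w\<in>V. \<bar>M i u w\<bar> * (\<omega> w * (2 * \<alpha>) ^ L * \<beta> ^ card (flip A i)))"
    using flip by (intro sum_mono mult_left_mono Suc.IH) auto
  also have "\<dots> = (2 * \<alpha>) ^ L * (\<Sum>i<n. r i * \<beta> ^ card (flip A i))"
    by (simp add: r_def sum_distrib_left sum_distrib_right mult_ac)
  also have "(\<Sum>i<n. r i * \<beta> ^ card (flip A i)) \<le> 2 * \<alpha> * \<omega> u * \<beta> ^ card A"
  proof -
    \<comment> \<open>An index outside \<open>A\<close> raises the power of \<beta>, and all of
      these together have weight at most N, paid for by \<open>N * \<beta> \<le> \<alpha>\<close>.
      An index in \<open>A\<close> lowers the power, but there are at most \<open>Lm\<close> of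
      them, each of weight at most \<kappa>, paid for by
      \<open>Lm * \<kappa> \<le> \<alpha> * \<beta>\<close>. Both groups cost \<alpha>, hence
      \<open>2 * \<alpha>\<close> per step.\<close>
    have "(\<Sum>i<n. r i * \<beta> ^ card (flip A i))
      = (\<Sum>i\<in>A. r i * \<beta> ^ card (flip A i)) + (\<Sum>i\<in>{..<n} - A. r i * \<beta> ^ card (flip A i))"
      using Suc.prems(1) by (subst sum.subset_diff[of A]) auto
    also have "(\<Sum>i\<in>{..<n} - A. r i * \<beta> ^ card (flip A i)) = (\<Sum>i\<in>{..<n} - A. r i) * \<beta> * \<beta> ^ card A"
      using finA unfolding sum_distrib_right by (intro sum.cong) (auto simp: flip_def)
    also have "\<dots> \<le> (N * \<omega> u) * \<beta> * \<beta> ^ card A"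
    proof (intro mult_right_mono)
      have "(\<Sum>i\<in>{..<n} - A. r i) \<le> (\<Sum>i<n. r i)" using r by (intro sum_mono2) auto
      also have "\<dots> \<le> N * \<omega> u" using total[OF Suc.prems(3)] by (simp add: r_def)
      finally show "(\<Sum>i\<in>{..<n} - A. r i) \<le> N * \<omega> u" .
    qed (use \<alpha> in auto)
    also have "\<dots> = (N * \<beta>) * (\<omega> u * \<beta> ^ card A)" by simp
    also have "\<dots> \<le> \<alpha> * (\<omega> u * \<beta> ^ card A)"
      using \<alpha> \<omega>[OF Suc.prems(3)] by (intro mult_right_mono) auto
    also have "(\<Sum>i\<in>A. r i * \<beta> ^ card (flip A i)) \<le> (\<Sum>i\<in>A. \<kappa> * \<omega> u * \<beta> ^ (card A - 1))"
    proof (intro sum_mono)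
      fix i assume i: "i \<in> A"
      hence "card (flip A i) = card A - 1" using finA by (simp add: flip_def)
      moreover have "r i \<le> \<kappa> * \<omega> u" using i Suc.prems row by (auto simp: r_def)
      ultimately show "r i * \<beta> ^ card (flip A i) \<le> \<kappa> * \<omega> u * \<beta> ^ (card A - 1)"
        using \<alpha> by (auto intro: mult_right_mono)
    qed
    also have "\<dots> = real (card A) * \<kappa> * (\<omega> u * \<beta> ^ (card A - 1))" by simp
    also have "\<dots> \<le> \<alpha> * (\<omega> u * \<beta> ^ card A)"
    \<comment> \<open>For empty \<open>A\<close> the subtraction \<open>card A - 1\<close> is
      truncated and the powers of \<beta> do not match, but the left side is 0.\<close>
    proof (cases "A = {}")
      case True
      thus ?thesis using \<alpha> \<omega>[OF Suc.prems(3)] by simp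
    next
      case False
      hence cA: "\<beta> ^ card A = \<beta> * \<beta> ^ (card A - 1)"
        using finA by (metis One_nat_def Suc_pred card_gt_0_iff power_Suc)
      have "real (card A) * \<kappa> \<le> \<alpha> * \<beta>"
        using \<alpha> Suc.prems(2) mult_right_mono[of "real (card A)" "real Lm" \<kappa>] by simp
      hence "real (card A) * \<kappa> * (\<omega> u * \<beta> ^ (card A - 1)) \<le> (\<alpha> * \<beta>) * (\<omega> u * \<beta> ^ (card A - 1))"
        using \<alpha> \<omega>[OF Suc.prems(3)] by (intro mult_right_mono) auto
      thus ?thesis by (simp add: cA mult_ac)
    qed
    finally show ?thesis by simp
  qed
  finally show ?case using \<alpha> by (simp add: mult_ac)
qed

lemma quad_form_scale: "quad_form V (\<lambda>u v. \<Sum>i\<in>I. c i * M i u v) y = (\<Sum>i\<in>I. c i * quad_form V (M i) y)"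
proof -
  have "(\<Sum>u\<in>V. \<Sum>v\<in>V. \<Sum>i\<in>I. c i * (y u * M i u v * y v))
    = (\<Sum>i\<in>I. \<Sum>u\<in>V. \<Sum>v\<in>V. c i * (y u * M i u v * y v))"
    by (subst (2) sum.swap, subst sum.swap) simp
  thus ?thesis
    by (simp add: quad_form_def sum_distrib_left sum_distrib_right mult_ac)
qed

text \<open>The vector \<open>y x\<close> may depend on the signs, because the trace bound holds for
  all vectors at once; only the trace is averaged. The truncation level \<theta> trades the moment
  of order \<open>2 ^ Suc h\<close> for a bound on the first moment.\<close>

lemma signed_quad_form_ave_le:
  fixes M :: "nat \<Rightarrow> 'v \<Rightarrow> 'v \<Rightarrow> real" and y :: "'x \<Rightarrow> 'v \<Rightarrow> real" and \<omega> :: "'v \<Rightarrow> real"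
  assumes V: "finite V" and \<omega>: "\<And>u. u \<in> V \<Longrightarrow> 0 < \<omega> u"
    and sym: "\<And>i u v. M i u v = M i v u"
    and row: "\<And>i u. i < n \<Longrightarrow> u \<in> V \<Longrightarrow> (\<Sum>v\<in>V. \<bar>M i u v\<bar> * \<omega> v) \<le> \<kappa> * \<omega> u"
    and total: "\<And>u. u \<in> V \<Longrightarrow> (\<Sum>i<n. \<Sum>v\<in>V. \<bar>M i u v\<bar> * \<omega> v) \<le> N * \<omega> u"
    and pos: "0 < \<kappa>" "0 < N" "0 < \<theta>"
    and y: "\<And>x. x \<in> X \<Longrightarrow> (\<Sum>u\<in>V. (y x u)\<^sup>2) \<le> Y"
  shows "ave (\<lambda>x. \<bar>\<Sum>i<n. \<epsilon> x i * quad_form V (M i) (y x)\<bar>)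
    \<le> \<theta> * (1 + real (card V) * (4 * N * 2 ^ Suc h * \<kappa> * Y\<^sup>2 / \<theta>\<^sup>2) ^ (2 ^ h))"
proof -
  define K :: nat where "K = 2 ^ Suc h"
  \<comment> \<open>This choice turns both conditions on \<alpha> and \<beta> in the walk bound into
    equalities and gives \<open>\<alpha> = sqrt (N * K * \<kappa>)\<close>.\<close>
  define \<beta> where "\<beta> = sqrt (real K * \<kappa> / N)"
  define \<alpha> where "\<alpha> = N * \<beta>"
  have "0 < real K" by (simp add: K_def)
  hence \<beta>: "0 < \<beta>" "\<beta>\<^sup>2 = real K * \<kappa> / N" using pos by (auto simp: \<beta>_def)
  have "\<alpha> * \<beta> = N * \<beta>\<^sup>2" "\<alpha>\<^sup>2 = N * (N * \<beta>\<^sup>2)"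
    by (simp_all add: \<alpha>_def power2_eq_square)
  hence \<alpha>: "0 < \<alpha>" "\<alpha> * \<beta> = real K * \<kappa>" "\<alpha>\<^sup>2 = N * (real K * \<kappa>)"
    using pos \<beta> by (simp_all add: \<alpha>_def)
  define S where "S x = (\<lambda>u v. \<Sum>i<n. \<epsilon> x i * M i u v)" for x
  define Z where "Z x = (\<Sum>i<n. \<epsilon> x i * quad_form V (M i) (y x))" for x
  have Ssym: "S x u v = S x v u" for x u v by (simp add: S_def sym)
  have Z: "Z x = quad_form V (S x) (y x)" for x
    by (simp add: Z_def S_def quad_form_scale)
  have tr: "ave (\<lambda>x. \<Sum>u\<in>V. mat_pow V (S x) K u u) \<le> real (card V) * (2 * \<alpha>) ^ K"
  proof -
    have "ave (\<lambda>x. mat_pow V (S x) K u u) \<le> (2 * \<alpha>) ^ K" if u: "u \<in> V" for u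
    proof -
      have "(\<Sum>v\<in>V. \<bar>ave (\<lambda>x. chi {} x * mat_pow V (S x) K u v)\<bar> * \<omega> v)
        \<le> \<omega> u * (2 * \<alpha>) ^ K * \<beta> ^ card ({} :: nat set)"
        unfolding S_def using pos \<alpha> \<beta>
        by (intro walk_sum_bound[where Lm = K and N = N and \<kappa> = \<kappa>] V \<omega> row total u)
          (auto simp: \<alpha>_def)
      moreover have "\<bar>ave (\<lambda>x. chi {} x * mat_pow V (S x) K u u)\<bar> * \<omega> u
        \<le> (\<Sum>v\<in>V. \<bar>ave (\<lambda>x. chi {} x * mat_pow V (S x) K u v)\<bar> * \<omega> v)"
        using V u \<omega> by (intro member_le_sum) (auto simp: less_imp_le)
      ultimately have "\<bar>ave (\<lambda>x. mat_pow V (S x) K u u)\<bar> * \<omega> u \<le> (2 * \<alpha>) ^ K * \<omega> u"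
        by (simp add: chi_def mult.commute)
      hence "\<bar>ave (\<lambda>x. mat_pow V (S x) K u u)\<bar> \<le> (2 * \<alpha>) ^ K"
        using \<omega>[OF u] by simp
      thus ?thesis by simp
    qed
    hence "(\<Sum>u\<in>V. ave (\<lambda>x. mat_pow V (S x) K u u)) \<le> (\<Sum>u\<in>V. (2 * \<alpha>) ^ K)"
      by (rule sum_mono)
    thus ?thesis by (simp add: ave_sum)
  qed
  have pointwise: "\<bar>Z x\<bar> \<le> \<theta> + \<theta> / \<theta> ^ K * (Y ^ K * (\<Sum>u\<in>V. mat_pow V (S x) K u u))"
    if x: "x \<in> X" for x
  proof -
    have trx: "0 \<le> (\<Sum>u\<in>V. mat_pow V (S x) K u u)"
      unfolding K_def power_Suc by (subst trace_double[OF V Ssym]) (auto intro!: sum_nonneg)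
    have "\<bar>Z x\<bar> ^ K \<le> (\<Sum>u\<in>V. (y x u)\<^sup>2) ^ K * (\<Sum>u\<in>V. mat_pow V (S x) K u u)"
      unfolding Z K_def by (rule quad_form_power_le_trace[OF V Ssym])
    also have "\<dots> \<le> Y ^ K * (\<Sum>u\<in>V. mat_pow V (S x) K u u)"
      by (rule mult_right_mono[OF power_mono[OF y[OF x]] trx]) (simp add: sum_nonneg)
    finally have le: "\<bar>Z x\<bar> ^ K \<le> Y ^ K * (\<Sum>u\<in>V. mat_pow V (S x) K u u)" .
    \<comment> \<open>Values up to \<theta> are paid for by \<theta>; for larger ones the ratio to
      \<theta> exceeds 1 and is at most its own \<open>K\<close>-th power.\<close>
    have "\<bar>Z x\<bar> \<le> \<theta> + \<theta> * (\<bar>Z x\<bar> / \<theta>) ^ K"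
    proof (cases "\<bar>Z x\<bar> \<le> \<theta>")
      case True
      thus ?thesis using pos by (intro add_increasing2) auto
    next
      case False
      hence "(\<bar>Z x\<bar> / \<theta>) ^ 1 \<le> (\<bar>Z x\<bar> / \<theta>) ^ K"
        using pos by (intro power_increasing) (auto simp: K_def field_simps)
      hence "\<theta> * (\<bar>Z x\<bar> / \<theta>) \<le> \<theta> * (\<bar>Z x\<bar> / \<theta>) ^ K" using pos by (intro mult_left_mono) auto
      thus ?thesis using pos by simp
    qed
    also have "\<theta> * (\<bar>Z x\<bar> / \<theta>) ^ K = \<theta> / \<theta> ^ K * \<bar>Z x\<bar> ^ K" by (simp add: power_divide)
    also have "\<dots> \<le> \<theta> / \<theta> ^ K * (Y ^ K * (\<Sum>u\<in>V. mat_pow V (S x) K u u))"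
      using pos le by (intro mult_left_mono) auto
    finally show ?thesis by simp
  qed
  obtain x0 where x0: "x0 \<in> X" using X_nonempty by blast
  have Y: "0 \<le> Y" using y[OF x0] by (rule order_trans[rotated]) (auto intro: sum_nonneg)
  have "ave (\<lambda>x. \<bar>Z x\<bar>) \<le> ave (\<lambda>x. \<theta> + \<theta> / \<theta> ^ K * (Y ^ K * (\<Sum>u\<in>V. mat_pow V (S x) K u u)))"
    by (rule ave_mono) (rule pointwise)
  also have "\<dots> = \<theta> + \<theta> / \<theta> ^ K * (Y ^ K * ave (\<lambda>x. \<Sum>u\<in>V. mat_pow V (S x) K u u))"
    by (simp only: ave_add ave_cmult ave_const)
  also have "\<dots> \<le> \<theta> + \<theta> / \<theta> ^ K * (Y ^ K * (real (card V) * (2 * \<alpha>) ^ K))"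
    using pos Y tr by (intro add_left_mono mult_left_mono) auto
  also have "\<dots> = \<theta> * (1 + real (card V) * (2 * \<alpha> * Y / \<theta>) ^ K)"
    by (simp add: power_mult_distrib power_divide distrib_left)
  \<comment> \<open>\<open>K\<close> is even, so squaring inside the power removes the square root
    hidden in \<alpha>.\<close>
  also have "(2 * \<alpha> * Y / \<theta>) ^ K = ((2 * \<alpha> * Y / \<theta>)\<^sup>2) ^ (2 ^ h)"
    by (simp add: K_def power_mult)
  also have "(2 * \<alpha> * Y / \<theta>)\<^sup>2 = 4 * N * 2 ^ Suc h * \<kappa> * Y\<^sup>2 / \<theta>\<^sup>2"
    by (simp add: power_mult_distrib power_divide \<alpha> K_def)
  finally show ?thesis by (simp only: Z_def)
qed

lemma sum_if_eq_pair:
  assumes "finite V" "s \<in> V" "t \<in> V"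
  shows "(\<Sum>u\<in>V. \<Sum>v\<in>V. f u v * (if s = u \<and> t = v then 1 else 0)) = (f s t :: real)"
proof -
  have "(\<Sum>u\<in>V. \<Sum>v\<in>V. f u v * (if s = u \<and> t = v then 1 else 0))
      = (\<Sum>u\<in>V. if s = u then (\<Sum>v\<in>V. if t = v then f u v else 0) else 0)"
    by (intro sum.cong refl) (auto intro!: sum.cong)
  thus ?thesis using assms by simp
qed

text \<open>
  The matrices are normalised by \<open>sqrt (\<mu> u) * sqrt (\<mu> v)\<close>; the vector \<open>sqrt (\<mu> u) * Y x u\<close> then
  has bounded norm however many cells there are.
\<close>

lemma two_query_ave_le:
  fixes a :: "nat \<Rightarrow> 'q \<Rightarrow> real" and \<sigma> :: "'q \<Rightarrow> real" and e1 e2 :: "'q \<Rightarrow> 'v"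
    and \<mu> :: "'v \<Rightarrow> real" and Y :: "'x \<Rightarrow> 'v \<Rightarrow> real"
  assumes V: "finite V" and Q: "finite Q" and \<mu>: "\<And>u. u \<in> V \<Longrightarrow> 0 < \<mu> u" "(\<Sum>u\<in>V. \<mu> u) \<le> 2"
    and e: "\<And>q. q \<in> Q \<Longrightarrow> e1 q \<in> V" "\<And>q. q \<in> Q \<Longrightarrow> e2 q \<in> V"
    and a: "\<And>i q. i < n \<Longrightarrow> q \<in> Q \<Longrightarrow> 0 \<le> a i q" and \<sigma>: "\<And>q. \<bar>\<sigma> q\<bar> \<le> 1"
    and Y: "\<And>x u. x \<in> X \<Longrightarrow> u \<in> V \<Longrightarrow> \<bar>Y x u\<bar> \<le> 1"
    and row: "\<And>i u. i < n \<Longrightarrow> u \<in> V \<Longrightarrow> (\<Sum>q | q \<in> Q \<and> u \<in> {e1 q, e2 q}. a i q) \<le> \<kappa> * \<mu> u"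
    and total: "\<And>u. u \<in> V \<Longrightarrow> (\<Sum>i<n. \<Sum>q | q \<in> Q \<and> u \<in> {e1 q, e2 q}. a i q) \<le> N * \<mu> u"
    and pos: "0 < \<kappa>" "0 < N" "0 < \<theta>"
  shows "ave (\<lambda>x. \<bar>\<Sum>i<n. \<epsilon> x i * (\<Sum>q\<in>Q. a i q * \<sigma> q * (Y x (e1 q) * Y x (e2 q)))\<bar>)
    \<le> \<theta> * (1 + real (card V) * (4 * N * 2 ^ Suc h * \<kappa> * 2\<^sup>2 / \<theta>\<^sup>2) ^ (2 ^ h))"
proof -
  define \<omega> where "\<omega> u = sqrt (\<mu> u)" for u
  define ind :: "'v \<Rightarrow> 'v \<Rightarrow> 'q \<Rightarrow> real" where
    "ind u v q = (if e1 q = u \<and> e2 q = v then 1 else 0)" for u v q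
  \<comment> \<open>Symmetrising, with the 2 in the denominator, leaves the quadratic form
    unchanged; the division by \<open>\<omega> u * \<omega> v\<close> is undone by the weights in
    \<open>y\<close>.\<close>
  define M where "M i u v = (\<Sum>q\<in>Q. a i q * \<sigma> q * (ind u v q + ind v u q)) / (2 * \<omega> u * \<omega> v)" for i u v
  define y where "y x u = \<omega> u * Y x u" for x u
  have \<omega>: "0 < \<omega> u" "\<omega> u * \<omega> u = \<mu> u" if "u \<in> V" for u
    using \<mu>(1)[OF that] by (auto simp: \<omega>_def)
  have ind: "0 \<le> ind u v q" for u v q by (simp add: ind_def)
  have sym: "M i u v = M i v u" for i u v
    unfolding M_def
    by (rule arg_cong2[of _ _ _ _ "(/)"]) (simp_all only: add.commute mult.assoc mult.commute[of "\<omega> u"])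
  \<comment> \<open>In the row sum weighted with \<omega> the factor \<open>\<omega> v\<close>
    cancels, and only the mass of the queries probing \<open>u\<close> remains. The same \<omega>
    therefore serves as the weight in the walk bound.\<close>
  have rowM: "(\<Sum>v\<in>V. \<bar>M i u v\<bar> * \<omega> v) \<le> (\<Sum>q | q \<in> Q \<and> u \<in> {e1 q, e2 q}. a i q) / \<omega> u"
    if i: "i < n" and u: "u \<in> V" for i u
  proof -
    have "(\<Sum>v\<in>V. \<bar>M i u v\<bar> * \<omega> v) \<le> (\<Sum>v\<in>V. (\<Sum>q\<in>Q. a i q * (ind u v q + ind v u q)) / (2 * \<omega> u))"
    proof (rule sum_mono)
      fix v assume v: "v \<in> V"
      define D where "D = (\<Sum>q\<in>Q. a i q * \<sigma> q * (ind u v q + ind v u q))"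
      have "\<bar>D\<bar> \<le> (\<Sum>q\<in>Q. \<bar>a i q * \<sigma> q * (ind u v q + ind v u q)\<bar>)"
        unfolding D_def by (rule sum_abs)
      also have "\<dots> \<le> (\<Sum>q\<in>Q. a i q * (ind u v q + ind v u q))"
      proof (rule sum_mono)
        fix q assume q: "q \<in> Q"
        have nn: "0 \<le> a i q * (ind u v q + ind v u q)"
          by (rule mult_nonneg_nonneg[OF a[OF i q] add_nonneg_nonneg[OF ind ind]])
        have "a i q * \<sigma> q * (ind u v q + ind v u q) = \<sigma> q * (a i q * (ind u v q + ind v u q))"
          by (simp only: mult_ac)
        hence "\<bar>a i q * \<sigma> q * (ind u v q + ind v u q)\<bar> = \<bar>\<sigma> q\<bar> * (a i q * (ind u v q + ind v u q))"
          by (simp only: abs_mult[of "\<sigma> q"] abs_of_nonneg[OF nn])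
        also have "\<dots> \<le> 1 * (a i q * (ind u v q + ind v u q))"
          by (rule mult_right_mono[OF \<sigma> nn])
        finally show "\<bar>a i q * \<sigma> q * (ind u v q + ind v u q)\<bar> \<le> a i q * (ind u v q + ind v u q)"
          by simp
      qed
      finally have D: "\<bar>D\<bar> \<le> (\<Sum>q\<in>Q. a i q * (ind u v q + ind v u q))" .
      have "\<bar>M i u v\<bar> = \<bar>D\<bar> / (2 * \<omega> u * \<omega> v)"
        using \<omega>(1)[OF u] \<omega>(1)[OF v] by (simp add: M_def D_def[symmetric])
      hence "\<bar>M i u v\<bar> * \<omega> v = \<bar>D\<bar> / (2 * \<omega> u)"
        using \<omega>(1)[OF v] by simp
      thus "\<bar>M i u v\<bar> * \<omega> v \<le> (\<Sum>q\<in>Q. a i q * (ind u v q + ind v u q)) / (2 * \<omega> u)"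
        using D \<omega>(1)[OF u] by (simp add: divide_right_mono)
    qed
    also have "\<dots> = (\<Sum>q\<in>Q. a i q * (\<Sum>v\<in>V. ind u v q + ind v u q)) / (2 * \<omega> u)"
      unfolding sum_divide_distrib[symmetric] by (subst sum.swap) (simp add: sum_distrib_left)
    \<comment> \<open>The factor 2 is attained when both probes of \<open>q\<close> hit
      \<open>u\<close>; it cancels the 2 of the symmetrisation.\<close>
    also have "(\<Sum>q\<in>Q. a i q * (\<Sum>v\<in>V. ind u v q + ind v u q))
        \<le> (\<Sum>q\<in>Q. if u \<in> {e1 q, e2 q} then 2 * a i q else 0)"
    proof (rule sum_mono)
      fix q assume q: "q \<in> Q"
      have "(\<Sum>v\<in>V. ind u v q) = (\<Sum>v\<in>V. if e2 q = v then (if e1 q = u then 1 else 0) else 0)"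
        "(\<Sum>v\<in>V. ind v u q) = (\<Sum>v\<in>V. if e1 q = v then (if e2 q = u then 1 else 0) else 0)"
        by (auto intro!: sum.cong simp: ind_def)
      hence "(\<Sum>v\<in>V. ind u v q + ind v u q) = (if e1 q = u then 1 else 0) + (if e2 q = u then 1 else 0)"
        using e[OF q] V by (simp add: sum.distrib)
      thus "a i q * (\<Sum>v\<in>V. ind u v q + ind v u q) \<le> (if u \<in> {e1 q, e2 q} then 2 * a i q else 0)"
        using a[OF i q] by auto
    qed
    also have "\<dots> = 2 * (\<Sum>q | q \<in> Q \<and> u \<in> {e1 q, e2 q}. a i q)"
      using Q by (simp add: sum.inter_filter[symmetric] sum_distrib_left)
    finally show ?thesis using \<omega>(1)[OF u] by (simp add: divide_right_mono)
  qed
  have qf: "quad_form V (M i) (y x) = (\<Sum>q\<in>Q. a i q * \<sigma> q * (Y x (e1 q) * Y x (e2 q)))" for i x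
  proof -
    have "quad_form V (M i) (y x)
      = (\<Sum>u\<in>V. \<Sum>v\<in>V. \<Sum>q\<in>Q. a i q * \<sigma> q * (Y x u * Y x v * (ind u v q + ind v u q) / 2))"
      unfolding quad_form_def
    proof (intro sum.cong refl)
      fix u v assume u: "u \<in> V" and v: "v \<in> V"
      have scale: "\<omega> u * Y x u * (D / (2 * \<omega> u * \<omega> v)) * (\<omega> v * Y x v) = D * (Y x u * Y x v / 2)" for D
        using \<omega>(1)[OF u] \<omega>(1)[OF v] by simp
      show "y x u * M i u v * y x v
        = (\<Sum>q\<in>Q. a i q * \<sigma> q * (Y x u * Y x v * (ind u v q + ind v u q) / 2))"
        unfolding y_def M_def scale sum_distrib_right by (intro sum.cong refl) simp
    qed
    also have "\<dots> = (\<Sum>q\<in>Q. \<Sum>u\<in>V. \<Sum>v\<in>V. a i q * \<sigma> q * (Y x u * Y x v * (ind u v q + ind v u q) / 2))"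
      by (subst (2) sum.swap, subst sum.swap) simp
    also have "\<dots> = (\<Sum>q\<in>Q. a i q * \<sigma> q * (Y x (e1 q) * Y x (e2 q)))"
    proof (rule sum.cong[OF refl])
      fix q assume q: "q \<in> Q"
      have 1: "(\<Sum>u\<in>V. \<Sum>v\<in>V. Y x u * Y x v * ind u v q) = Y x (e1 q) * Y x (e2 q)"
        unfolding ind_def by (rule sum_if_eq_pair[OF V e(1)[OF q] e(2)[OF q]])
      have 2: "(\<Sum>u\<in>V. \<Sum>v\<in>V. Y x u * Y x v * ind v u q) = Y x (e1 q) * Y x (e2 q)"
        using 1 by (subst sum.swap) (simp add: mult.commute[of "Y x _" "Y x _"])
      have "(\<Sum>u\<in>V. \<Sum>v\<in>V. a i q * \<sigma> q * (Y x u * Y x v * (ind u v q + ind v u q) / 2))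
        = a i q * \<sigma> q * (((\<Sum>u\<in>V. \<Sum>v\<in>V. Y x u * Y x v * ind u v q)
            + (\<Sum>u\<in>V. \<Sum>v\<in>V. Y x u * Y x v * ind v u q)) / 2)"
        by (simp add: sum_distrib_left[symmetric] sum_divide_distrib[symmetric] distrib_left sum.distrib)
      thus "(\<Sum>u\<in>V. \<Sum>v\<in>V. a i q * \<sigma> q * (Y x u * Y x v * (ind u v q + ind v u q) / 2))
        = a i q * \<sigma> q * (Y x (e1 q) * Y x (e2 q))"
        by (simp add: 1 2)
    qed
    finally show ?thesis .
  qed
  have "ave (\<lambda>x. \<bar>\<Sum>i<n. \<epsilon> x i * quad_form V (M i) (y x)\<bar>)
    \<le> \<theta> * (1 + real (card V) * (4 * N * 2 ^ Suc h * \<kappa> * 2\<^sup>2 / \<theta>\<^sup>2) ^ (2 ^ h))"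
  proof (rule signed_quad_form_ave_le[OF V \<omega>(1) sym _ _ pos])
    fix i u assume i: "i < n" and u: "u \<in> V"
    have "(\<Sum>q | q \<in> Q \<and> u \<in> {e1 q, e2 q}. a i q) / \<omega> u \<le> \<kappa> * \<mu> u / \<omega> u"
      using row[OF i u] \<omega>(1)[OF u] by (intro divide_right_mono) auto
    also have "\<dots> = \<kappa> * \<omega> u" using \<omega>[OF u] by (simp add: field_simps)
    finally show "(\<Sum>v\<in>V. \<bar>M i u v\<bar> * \<omega> v) \<le> \<kappa> * \<omega> u"
      using rowM[OF i u] by linarith
  next
    fix u assume u: "u \<in> V"
    have "(\<Sum>i<n. \<Sum>v\<in>V. \<bar>M i u v\<bar> * \<omega> v) \<le> (\<Sum>i<n. (\<Sum>q | q \<in> Q \<and> u \<in> {e1 q, e2 q}. a i q) / \<omega> u)"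
      by (intro sum_mono rowM u) auto
    also have "\<dots> \<le> N * \<mu> u / \<omega> u"
      unfolding sum_divide_distrib[symmetric] using total[OF u] \<omega>(1)[OF u] by (intro divide_right_mono) auto
    also have "\<dots> = N * \<omega> u" using \<omega>[OF u] by (simp add: field_simps)
    finally show "(\<Sum>i<n. \<Sum>v\<in>V. \<bar>M i u v\<bar> * \<omega> v) \<le> N * \<omega> u" .
  next
    fix x assume x: "x \<in> X"
    have "(\<Sum>u\<in>V. (y x u)\<^sup>2) \<le> (\<Sum>u\<in>V. \<mu> u)"
    proof (rule sum_mono)
      fix u assume u: "u \<in> V"
      have "(y x u)\<^sup>2 = \<mu> u * (Y x u)\<^sup>2" using \<omega>[OF u] by (simp add: y_def power2_eq_square)
      also have "\<dots> \<le> \<mu> u * 1"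
        using \<mu>(1)[OF u] Y[OF x u] by (intro mult_left_mono) (auto simp: abs_square_le_1)
      finally show "(y x u)\<^sup>2 \<le> \<mu> u" by simp
    qed
    thus "(\<Sum>u\<in>V. (y x u)\<^sup>2) \<le> 2" using \<mu>(2) by linarith
  qed
  thus ?thesis by (simp only: qf)
qed

end

section \<open>The noise kernel of the cube\<close>

text \<open>The kernel of the noise operator with correlation \<open>1 - 2 * \<delta>\<close>; for
  \<open>\<delta> = 1 / (2 * c)\<close> the correlation is \<open>1 - 1 / c\<close>.\<close>

definition noise_kernel :: "real \<Rightarrow> int list \<Rightarrow> int list \<Rightarrow> real" where
  "noise_kernel \<delta> p q = pmf (flip_coords \<delta> p) q"

lemma hamming_cube_0: "hamming_cube 0 = {[]}"
  by (auto simp: hamming_cube_def)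

lemma hamming_cube_Suc: "hamming_cube (Suc d) = (#) (-1) ` hamming_cube d \<union> (#) 1 ` hamming_cube d"
  by (auto simp: hamming_cube_def length_Suc_conv image_iff)

lemma finite_hamming_cube: "finite (hamming_cube d)"
  by (induction d) (auto simp: hamming_cube_0 hamming_cube_Suc)

lemma sum_hamming_cube_Suc:
  "(\<Sum>p\<in>hamming_cube (Suc d). f p) = (\<Sum>p\<in>hamming_cube d. f (-1 # p) + (f (1 # p) :: real))"
  by (subst hamming_cube_Suc, subst sum.union_disjoint)
    (auto simp: finite_hamming_cube sum.reindex inj_on_def sum.distrib)

lemma card_hamming_cube: "card (hamming_cube d) = 2 ^ d"
proof (induction d)
  case (Suc d)
  thus ?case
    by (subst hamming_cube_Suc, subst card_Un_disjoint)
      (auto simp: finite_hamming_cube card_image inj_on_def)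
qed (simp add: hamming_cube_0)

lemma hamming_cube_nonempty: "hamming_cube d \<noteq> {}"
  using card_hamming_cube[of d] by (metis card.empty power_not_zero zero_neq_numeral)

lemma flip_coords_Cons:
  "flip_coords \<delta> (a # v) = map_pmf (\<lambda>(b, q). b # q)
     (pair_pmf (map_pmf (\<lambda>b. if b then - a else a) (bernoulli_pmf \<delta>)) (flip_coords \<delta> v))"
  by (simp add: flip_coords_def pair_pmf_def map_pmf_def bind_assoc_pmf bind_return_pmf)

lemma set_pmf_flip_coords: "v \<in> hamming_cube d \<Longrightarrow> set_pmf (flip_coords \<delta> v) \<subseteq> hamming_cube d"
proof (induction v arbitrary: d)
  case Nil
  thus ?case by (auto simp: flip_coords_def bind_return_pmf)
next
  case (Cons a v)
  then obtain d' where d: "d = Suc d'" "v \<in> hamming_cube d'" "a \<in> {-1, 1}"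
    by (auto simp: hamming_cube_def length_Suc_conv)
  show ?case
    using Cons.IH[OF d(2)] d by (auto simp: flip_coords_Cons hamming_cube_Suc split: if_splits)
qed

lemma noise_kernel_nonneg: "0 \<le> noise_kernel \<delta> p q"
  by (simp add: noise_kernel_def)

lemma noise_kernel_Nil: "noise_kernel \<delta> [] [] = 1"
  by (simp add: noise_kernel_def flip_coords_def bind_return_pmf)

lemma noise_kernel_Cons:
  assumes "0 \<le> \<delta>" "\<delta> \<le> 1" "a \<in> {-1, 1}" "b \<in> {-1, 1}"
  shows "noise_kernel \<delta> (a # p) (b # q) = (if a = b then 1 - \<delta> else \<delta>) * noise_kernel \<delta> p q"
proof -
  have inj: "inj (\<lambda>(b :: int, q). b # q)" by (auto simp: inj_on_def)
  have inj2: "inj (\<lambda>f. if f then - a else a)" using assms(3) by (auto simp: inj_on_def)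
  have "pmf (map_pmf (\<lambda>f. if f then - a else a) (bernoulli_pmf \<delta>)) b
    = pmf (map_pmf (\<lambda>f. if f then - a else a) (bernoulli_pmf \<delta>)) ((\<lambda>f. if f then - a else a) (a \<noteq> b))"
    using assms by auto
  also have "\<dots> = pmf (bernoulli_pmf \<delta>) (a \<noteq> b)" by (rule pmf_map_inj'[OF inj2])
  also have "\<dots> = (if a = b then 1 - \<delta> else \<delta>)" using assms by simp
  finally show ?thesis
    using pmf_map_inj'[OF inj, of _ "(b, q)"] by (simp add: noise_kernel_def flip_coords_Cons pmf_pair)
qed

lemma noise_kernel_row_sum:
  assumes "p \<in> hamming_cube d"
  shows "(\<Sum>q\<in>hamming_cube d. noise_kernel \<delta> p q) = 1"
  unfolding noise_kernel_def
  by (rule sum_pmf_eq_1[OF finite_hamming_cube set_pmf_flip_coords[OF assms]])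

text \<open>Hence the query of a uniform data point is itself uniform, and the fraction of queries
  that probe a cell equals the mean over the data points of the mass they send there. In each
  coordinate the two columns sum to \<open>\<delta> + (1 - \<delta>)\<close>.\<close>

lemma noise_kernel_column_sum:
  assumes "0 \<le> \<delta>" "\<delta> \<le> 1" "q \<in> hamming_cube d"
  shows "(\<Sum>p\<in>hamming_cube d. noise_kernel \<delta> p q) = 1"
  using assms(3)
proof (induction d arbitrary: q)
  case 0
  thus ?case by (simp add: hamming_cube_0 noise_kernel_Nil)
next
  case (Suc d)
  then obtain b q' where q: "q = b # q'" "b \<in> {-1, 1}" "q' \<in> hamming_cube d"
    by (auto simp: hamming_cube_Suc)
  have "(\<Sum>p\<in>hamming_cube (Suc d). noise_kernel \<delta> p q) = (\<Sum>p\<in>hamming_cube d. noise_kernel \<delta> p q')"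
    unfolding sum_hamming_cube_Suc q(1) using q(2) assms
    by (intro sum.cong refl) (auto simp: noise_kernel_Cons algebra_simps)
  thus ?case using Suc.IH[OF q(3)] by simp
qed

text \<open>Tensorisation: the first coordinate splits the form into four forms on the smaller cube,
  each bounded by a product of slice norms. The two-point inequality for the slice norms reassembles
  the full norms.\<close>

lemma noise_kernel_hypercontractive:
  fixes p q r \<tau> \<delta> :: real
  assumes p: "1 < p" and pq: "p < q" and q: "q \<le> 2" and \<tau>: "\<tau>\<^sup>2 * (q - 1) = p - 1"
    and \<tau>1: "\<bar>\<tau>\<bar> \<le> 1" and r: "1 / r + 1 / q = 1" and \<delta>: "\<tau> = 1 - 2 * \<delta>"
    and nn: "\<And>u. 0 \<le> f u" "\<And>u. 0 \<le> g u"
  shows "(\<Sum>u\<in>hamming_cube d. \<Sum>v\<in>hamming_cube d. f u * noise_kernel \<delta> u v * g v) / 2 ^ d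
    \<le> ((\<Sum>u\<in>hamming_cube d. f u powr r) / 2 ^ d) powr (1 / r)
      * ((\<Sum>v\<in>hamming_cube d. g v powr p) / 2 ^ d) powr (1 / p)"
  using nn
proof (induction d arbitrary: f g)
  case 0
  have "1 / q < 1" using p pq by simp
  with r have "1 / r > 0" by linarith
  hence "r > 0" by simp
  thus ?case using 0 p by (simp add: hamming_cube_0 noise_kernel_Nil powr_powr)
next
  case (Suc d)
  have \<delta>01: "0 \<le> \<delta>" "\<delta> \<le> 1" using \<delta> \<tau>1 by auto
  have "1 / q < 1" using p pq by simp
  with r have "1 / r > 0" by linarith
  hence rpos: "r > 0" by simp
  define F where "F a = ((\<Sum>u\<in>hamming_cube d. f (a # u) powr r) / 2 ^ d) powr (1 / r)" for a
  define G where "G a = ((\<Sum>u\<in>hamming_cube d. g (a # u) powr p) / 2 ^ d) powr (1 / p)" for a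
  define B where "B a b = (\<Sum>u\<in>hamming_cube d. \<Sum>v\<in>hamming_cube d. f (a # u) * noise_kernel \<delta> u v * g (b # v))" for a b
  have B: "B a b / 2 ^ d \<le> F a * G b" for a b
    unfolding B_def F_def G_def by (rule Suc.IH) (auto simp: Suc.prems)
  have FG: "0 \<le> F a" "0 \<le> G a" for a by (auto simp: F_def G_def)
  have scale: "(a * (x + y) + b * (z + w)) / 2 ^ Suc d
    = (a * (x / 2 ^ d + y / 2 ^ d) + b * (z / 2 ^ d + w / 2 ^ d)) / 2" for a b x y z w :: real
    by (simp add: add_divide_distrib distrib_left)
  have "(\<Sum>u\<in>hamming_cube (Suc d). \<Sum>v\<in>hamming_cube (Suc d). f u * noise_kernel \<delta> u v * g v)
    = (1 - \<delta>) * (B (-1) (-1) + B 1 1) + \<delta> * (B (-1) 1 + B 1 (-1))"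
    unfolding sum_hamming_cube_Suc B_def sum_distrib_left sum.distrib[symmetric]
    by (intro sum.cong refl) (simp add: noise_kernel_Cons \<delta>01 algebra_simps)
  hence "(\<Sum>u\<in>hamming_cube (Suc d). \<Sum>v\<in>hamming_cube (Suc d). f u * noise_kernel \<delta> u v * g v) / 2 ^ Suc d
    = ((1 - \<delta>) * (B (-1) (-1) / 2 ^ d + B 1 1 / 2 ^ d) + \<delta> * (B (-1) 1 / 2 ^ d + B 1 (-1) / 2 ^ d)) / 2"
    by (simp only: scale)
  also have "\<dots> \<le> ((1 - \<delta>) * (F (-1) * G (-1) + F 1 * G 1) + \<delta> * (F (-1) * G 1 + F 1 * G (-1))) / 2"
    using \<delta>01 by (intro divide_right_mono add_mono mult_left_mono B) auto
  also have "\<dots> = ((1 + \<tau>) / 2 * (F (-1) * G (-1) + F 1 * G 1) + (1 - \<tau>) / 2 * (F (-1) * G 1 + F 1 * G (-1))) / 2"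
    by (simp add: \<delta>)
  also have "\<dots> \<le> ((F (-1) powr r + F 1 powr r) / 2) powr (1 / r) * ((G (-1) powr p + G 1 powr p) / 2) powr (1 / p)"
    by (rule two_point_bilinear[OF p pq q \<tau> \<tau>1 r FG(1) FG(1) FG(2) FG(2)])
  also have "(F (-1) powr r + F 1 powr r) / 2 = (\<Sum>u\<in>hamming_cube (Suc d). f u powr r) / 2 ^ Suc d"
    using rpos by (simp add: F_def powr_powr sum_hamming_cube_Suc sum_nonneg sum.distrib add_divide_distrib)
  also have "(G (-1) powr p + G 1 powr p) / 2 = (\<Sum>u\<in>hamming_cube (Suc d). g u powr p) / 2 ^ Suc d"
    using p by (simp add: G_def powr_powr sum_hamming_cube_Suc sum_nonneg sum.distrib add_divide_distrib)
  finally show ?case .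
qed

section \<open>The noise operator on indicators of query sets, and its upper tail\<close>

definition noisy_mass :: "real \<Rightarrow> int list set \<Rightarrow> int list \<Rightarrow> real" where
  "noisy_mass \<delta> A p = (\<Sum>q\<in>A. noise_kernel \<delta> p q)"

lemma noisy_mass_nonneg: "0 \<le> noisy_mass \<delta> A p"
  by (simp add: noisy_mass_def sum_nonneg noise_kernel_nonneg)

text \<open>
  For small \<open>\<zeta>\<close> the bound is about \<open>\<mu> * (\<mu> powr (- \<tau>\<^sup>2) / \<kappa>) powr \<zeta>\<close>, which is where the exponent
  \<open>1 / \<tau>\<^sup>2\<close> of the theorem comes from.
\<close>

lemma noisy_mass_tail:
  fixes \<tau> \<delta> \<zeta> \<kappa> :: real
  assumes \<tau>: "0 < \<tau>" "\<tau> < 1" "\<tau> = 1 - 2 * \<delta>" and \<zeta>: "0 < \<zeta>" "\<zeta> \<le> 1" and \<kappa>: "0 < \<kappa>"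
    and A: "A \<subseteq> hamming_cube d" "A \<noteq> {}"
  defines "\<mu> \<equiv> real (card A) / 2 ^ d"
  shows "(\<Sum>p | p \<in> hamming_cube d \<and> \<kappa> * \<mu> < noisy_mass \<delta> A p. noisy_mass \<delta> A p) / 2 ^ d
    \<le> \<mu> powr ((1 + \<zeta>) / (1 + \<tau>\<^sup>2 * \<zeta>)) * (\<kappa> * \<mu>) powr (- \<zeta>)"
proof -
  \<comment> \<open>The exponents \<open>s\<close> and \<open>t\<close> satisfy
    \<open>\<tau>\<^sup>2 * (s - 1) = t - 1\<close>, as hypercontractivity demands, and
    \<open>r\<close> is conjugate to \<open>s\<close>; \<open>\<zeta> \<le> 1\<close> gives
    \<open>s \<le> 2\<close>.\<close>
  define s where "s = 1 + \<zeta>"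
  define t where "t = 1 + \<tau>\<^sup>2 * \<zeta>"
  define r where "r = s / \<zeta>"
  define B where "B = {p. p \<in> hamming_cube d \<and> \<kappa> * \<mu> < noisy_mass \<delta> A p}"
  define x where "x = (\<Sum>p\<in>B. noisy_mass \<delta> A p) / 2 ^ d"
  have finA: "finite A" using A finite_hamming_cube finite_subset by blast
  have finB: "finite B" "B \<subseteq> hamming_cube d" using finite_hamming_cube by (auto simp: B_def)
  have \<mu>: "0 < \<mu>" using A finA by (simp add: \<mu>_def card_gt_0_iff)
  have \<tau>2: "0 < \<tau>\<^sup>2" "\<tau>\<^sup>2 < 1" using \<tau> by (auto simp: abs_square_less_1)
  have s: "1 < s" "s \<le> 2" "s - 1 = \<zeta>" using \<zeta> by (auto simp: s_def)
  have t: "1 < t" "t < s" "t - 1 = \<tau>\<^sup>2 * \<zeta>" using \<zeta> \<tau>2 by (auto simp: s_def t_def)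
  have r: "1 / r + 1 / s = 1" "1 / r = \<zeta> / s" "r \<noteq> 0"
    using \<zeta> s by (auto simp: r_def field_simps s_def)
  have x_hyper: "x \<le> (real (card B) / 2 ^ d) powr (\<zeta> / s) * \<mu> powr (1 / t)"
  proof -
    have "x = (\<Sum>u\<in>hamming_cube d. \<Sum>v\<in>hamming_cube d. indicator B u * noise_kernel \<delta> u v * indicator A v) / 2 ^ d"
    proof -
      have "(\<Sum>u\<in>hamming_cube d. \<Sum>v\<in>hamming_cube d. indicator B u * noise_kernel \<delta> u v * indicator A v)
        = (\<Sum>u\<in>hamming_cube d. if u \<in> B then (\<Sum>v\<in>hamming_cube d. if v \<in> A then noise_kernel \<delta> u v else 0) else 0)"
        by (intro sum.cong refl) (auto simp: indicator_def intro!: sum.cong)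
      also have "\<dots> = (\<Sum>u\<in>hamming_cube d. if u \<in> B then noisy_mass \<delta> A u else 0)"
      proof -
        have "(\<Sum>v\<in>hamming_cube d. if v \<in> A then noise_kernel \<delta> u v else 0) = noisy_mass \<delta> A u" for u
          using sum.inter_restrict[OF finite_hamming_cube, of "noise_kernel \<delta> u" d A] A(1)
          by (simp add: Int_absorb1 noisy_mass_def)
        thus ?thesis by (simp cong: if_cong)
      qed
      also have "\<dots> = (\<Sum>u\<in>B. noisy_mass \<delta> A u)"
        using finB finite_hamming_cube by (simp add: sum.If_cases Int_absorb1)
      finally show ?thesis by (simp add: x_def)
    qed
    also have "\<dots> \<le> ((\<Sum>u\<in>hamming_cube d. indicator B u powr r) / 2 ^ d) powr (1 / r)
      * ((\<Sum>v\<in>hamming_cube d. indicator A v powr t) / 2 ^ d) powr (1 / t)"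
      using s t r(1) \<tau> by (intro noise_kernel_hypercontractive[where q = s and \<tau> = \<tau>]) auto
    also have "(\<Sum>u\<in>hamming_cube d. indicator B u powr r) = real (card B)"
    proof -
      have "(\<Sum>u\<in>hamming_cube d. indicator B u powr r) = (\<Sum>u\<in>hamming_cube d. if u \<in> B then 1 else 0 :: real)"
        by (intro sum.cong refl) (auto simp: indicator_def)
      thus ?thesis using finB finite_hamming_cube by (simp add: sum.If_cases Int_absorb1)
    qed
    also have "(\<Sum>v\<in>hamming_cube d. indicator A v powr t) = real (card A)"
    proof -
      have "(\<Sum>u\<in>hamming_cube d. indicator A u powr t) = (\<Sum>u\<in>hamming_cube d. if u \<in> A then 1 else 0 :: real)"
        by (intro sum.cong refl) (auto simp: indicator_def)
      thus ?thesis using A finite_hamming_cube by (simp add: sum.If_cases Int_absorb1)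
    qed
    finally show ?thesis by (simp add: \<mu>_def r(2))
  qed
  have x0: "0 \<le> x" by (simp add: x_def sum_nonneg noisy_mass_nonneg)
  have "x \<le> \<mu> powr (s / t) * (\<kappa> * \<mu>) powr (- \<zeta>)"
  proof (cases "x = 0")
    case False
    with x0 have x: "0 < x" by simp
    \<comment> \<open>Markov's inequality bounds \<open>card B\<close> by means of \<open>x\<close>
      itself. Inserted into the hypercontractive estimate, it leaves \<open>x\<close> on the right
      with the exponent \<open>\<zeta> / s < 1\<close>, so that the inequality can be solved for
      \<open>x\<close>.\<close>
    have "real (card B) * (\<kappa> * \<mu>) \<le> (\<Sum>p\<in>B. noisy_mass \<delta> A p)"
      by (rule sum_bounded_below) (auto simp: B_def)
    hence "real (card B) / 2 ^ d \<le> x / (\<kappa> * \<mu>)"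
      using \<kappa> \<mu> by (simp add: x_def field_simps)
    hence "(real (card B) / 2 ^ d) powr (\<zeta> / s) * \<mu> powr (1 / t) \<le> (x / (\<kappa> * \<mu>)) powr (\<zeta> / s) * \<mu> powr (1 / t)"
      using \<zeta> s by (intro mult_right_mono powr_mono2) auto
    with x_hyper have "x \<le> (x / (\<kappa> * \<mu>)) powr (\<zeta> / s) * \<mu> powr (1 / t)" by linarith
    hence "x powr s \<le> ((x / (\<kappa> * \<mu>)) powr (\<zeta> / s) * \<mu> powr (1 / t)) powr s"
      using x s by (intro powr_mono2) auto
    also have "\<dots> = (x / (\<kappa> * \<mu>)) powr \<zeta> * \<mu> powr (s / t)"
      using s unfolding powr_mult by (simp add: powr_powr)
    also have "(x / (\<kappa> * \<mu>)) powr \<zeta> = x powr \<zeta> * (\<kappa> * \<mu>) powr (- \<zeta>)"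
      unfolding powr_divide powr_minus by (rule divide_inverse)
    also have "x powr s = x powr \<zeta> * x" using x by (simp add: s_def powr_add)
    finally have "x powr \<zeta> * x \<le> x powr \<zeta> * (\<mu> powr (s / t) * (\<kappa> * \<mu>) powr (- \<zeta>))"
      by (simp only: mult_ac)
    thus ?thesis using x by simp
  qed simp
  thus ?thesis by (simp add: x_def B_def s_def t_def)
qed

section \<open>Two-query correlation with random signs\<close>

definition datasets :: "'a set \<Rightarrow> nat \<Rightarrow> 'a list set" where
  "datasets C n = {P. set P \<subseteq> C \<and> length P = n}"

lemma finite_datasets: "finite C \<Longrightarrow> finite (datasets C n)"
  unfolding datasets_def by (rule finite_lists_length_eq)

lemma card_datasets: "finite C \<Longrightarrow> card (datasets C n) = card C ^ n"
  unfolding datasets_def by (rule card_lists_length_eq)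

lemma sum_datasets_Suc:
  assumes "finite C"
  shows "(\<Sum>P\<in>datasets C (Suc n). f P) = (\<Sum>p\<in>C. \<Sum>P\<in>datasets C n. (f (p # P) :: real))"
proof -
  have "datasets C (Suc n) = (\<lambda>(p, P). p # P) ` (C \<times> datasets C n)"
    by (force simp: datasets_def length_Suc_conv)
  moreover have "inj_on (\<lambda>(p, P). p # P) (C \<times> datasets C n)" by (auto simp: inj_on_def)
  ultimately show ?thesis
    by (simp add: sum.reindex sum.cartesian_product case_prod_unfold)
qed

lemma sum_datasets_prod:
  fixes g :: "'a \<Rightarrow> real"
  assumes "finite C"
  shows "(\<Sum>P\<in>datasets C n. \<Prod>i<n. g (P ! i)) = (\<Sum>p\<in>C. g p) ^ n"
proof (induction n)
  case 0
  have "datasets C 0 = {[]}" by (auto simp: datasets_def)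
  thus ?case by simp
next
  case (Suc n)
  have "(\<Sum>P\<in>datasets C (Suc n). \<Prod>i<Suc n. g (P ! i))
    = (\<Sum>p\<in>C. \<Sum>P\<in>datasets C n. g p * (\<Prod>i<n. g (P ! i)))"
    by (simp add: sum_datasets_Suc assms prod.lessThan_Suc_shift del: prod.lessThan_Suc)
  thus ?case by (simp add: Suc sum_distrib_left[symmetric] sum_distrib_right[symmetric])
qed

lemma sum_datasets_sum:
  fixes g :: "'a \<Rightarrow> real"
  assumes "finite C" "C \<noteq> {}"
  shows "(\<Sum>P\<in>datasets C n. \<Sum>i<n. g (P ! i))
    = real (card C) ^ n * (real n * ((\<Sum>p\<in>C. g p) / real (card C)))"
proof (induction n)
  case 0
  have "datasets C 0 = {[]}" by (auto simp: datasets_def)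
  thus ?case by simp
next
  case (Suc n)
  have C: "real (card C) \<noteq> 0" using assms by simp
  have "(\<Sum>P\<in>datasets C (Suc n). \<Sum>i<Suc n. g (P ! i))
    = (\<Sum>p\<in>C. \<Sum>P\<in>datasets C n. g p + (\<Sum>i<n. g (P ! i)))"
    by (simp add: sum_datasets_Suc assms sum.lessThan_Suc_shift del: sum.lessThan_Suc)
  also have "\<dots> = (\<Sum>p\<in>C. g p) * real (card C) ^ n
    + real (card C) * (real (card C) ^ n * (real n * ((\<Sum>p\<in>C. g p) / real (card C))))"
    by (simp add: sum.distrib Suc card_datasets assms sum_distrib_right[symmetric] mult.commute)
  finally show ?case using C by (simp add: field_simps)
qed

text \<open>Exponential Markov inequality with parameter \<open>1 / \<kappa>\<close>, for which the
  exponents lie in the unit interval, where \<open>exp y \<le> 1 + 2 * y\<close>. The exponential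
  moment costs \<open>2 * n / \<kappa>\<close> in the exponent, the threshold \<open>4 * n\<close>
  gains \<open>4 * n / \<kappa>\<close>.\<close>

lemma card_datasets_large_sum:
  fixes g :: "'a \<Rightarrow> real"
  assumes C: "finite C" "C \<noteq> {}" and \<kappa>: "0 < \<kappa>"
    and g: "\<And>p. p \<in> C \<Longrightarrow> 0 \<le> g p" "\<And>p. p \<in> C \<Longrightarrow> g p \<le> \<kappa>"
    and mean: "(\<Sum>p\<in>C. g p) \<le> real (card C)"
  shows "real (card {P \<in> datasets C n. 4 * real n < (\<Sum>i<n. g (P ! i))})
    \<le> real (card C) ^ n * exp (- 2 * real n / \<kappa>)"
proof -
  define B where "B = {P \<in> datasets C n. 4 * real n < (\<Sum>i<n. g (P ! i))}"
  have "real (card B) * exp (4 * real n / \<kappa>) \<le> (\<Sum>P\<in>B. exp ((\<Sum>i<n. g (P ! i)) / \<kappa>))"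
    using \<kappa> by (intro sum_bounded_below) (auto simp: B_def divide_right_mono)
  also have "\<dots> \<le> (\<Sum>P\<in>datasets C n. exp ((\<Sum>i<n. g (P ! i)) / \<kappa>))"
    by (intro sum_mono2 finite_datasets C) (auto simp: B_def)
  also have "\<dots> = (\<Sum>P\<in>datasets C n. \<Prod>i<n. exp (g (P ! i) / \<kappa>))"
    by (simp add: sum_divide_distrib exp_sum)
  also have "\<dots> = (\<Sum>p\<in>C. exp (g p / \<kappa>)) ^ n"
    by (rule sum_datasets_prod[OF C(1)])
  also have "\<dots> \<le> (real (card C) * exp (2 / \<kappa>)) ^ n"
  proof (intro power_mono sum_nonneg)
    have "(\<Sum>p\<in>C. exp (g p / \<kappa>)) \<le> (\<Sum>p\<in>C. 1 + 2 / \<kappa> * g p)"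
    proof (rule sum_mono)
      fix p assume p: "p \<in> C"
      define y where "y = g p / \<kappa>"
      have y: "0 \<le> y" "y \<le> 1" using g[OF p] \<kappa> by (auto simp: y_def)
      hence "y\<^sup>2 \<le> y" by (simp add: power2_eq_square mult_left_le)
      hence "exp y \<le> 1 + 2 * y" using exp_bound[OF y] by simp
      thus "exp (g p / \<kappa>) \<le> 1 + 2 / \<kappa> * g p" by (simp add: y_def)
    qed
    also have "\<dots> = real (card C) + 2 / \<kappa> * (\<Sum>p\<in>C. g p)"
      by (simp add: sum.distrib sum_distrib_left)
    also have "\<dots> \<le> real (card C) + 2 / \<kappa> * real (card C)"
      using mean \<kappa> by (intro add_left_mono mult_left_mono) auto
    also have "\<dots> = real (card C) * (1 + 2 / \<kappa>)" by (simp add: distrib_left)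
    also have "\<dots> \<le> real (card C) * exp (2 / \<kappa>)"
      by (intro mult_left_mono exp_ge_add_one_self) auto
    finally show "(\<Sum>p\<in>C. exp (g p / \<kappa>)) \<le> real (card C) * exp (2 / \<kappa>)" .
  qed auto
  also have "\<dots> = real (card C) ^ n * exp (- 2 * real n / \<kappa>) * exp (4 * real n / \<kappa>)"
    by (simp add: power_mult_distrib exp_of_nat_mult[symmetric] exp_add[symmetric] mult.assoc
        add_divide_distrib[symmetric])
  finally show ?thesis by (simp add: B_def)
qed

context random_signs
begin

text \<open>The kernel is split into a kept part \<open>a\<close> and discarded mass
  \<open>b\<close>. The mean of \<open>b\<close> accounts for the first summand, a union bound over
  the cells for atypical datasets for the second, and the moment bound for the kept part, with
  \<open>N = 4 * real n\<close>, for the third.\<close>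

lemma two_query_correlation_le:
  fixes \<tau> \<delta> \<zeta> \<kappa> t \<eta> \<theta> :: real and e1 e2 :: "int list \<Rightarrow> 'v" and \<sigma> :: "int list \<Rightarrow> real"
    and Y :: "int list list \<Rightarrow> 'x \<Rightarrow> 'v \<Rightarrow> real"
    and d :: nat
  defines "C \<equiv> hamming_cube d"
  assumes \<tau>: "0 < \<tau>" "\<tau> < 1" "\<tau> = 1 - 2 * \<delta>" and \<zeta>: "0 < \<zeta>" "\<zeta> \<le> 1"
    and pos: "0 < \<kappa>" "0 < t" "0 < \<theta>" "0 < n" "0 \<le> \<eta>"
    and V: "finite V" and e: "\<And>q. q \<in> C \<Longrightarrow> e1 q \<in> V" "\<And>q. q \<in> C \<Longrightarrow> e2 q \<in> V"
    and \<sigma>: "\<And>q. \<bar>\<sigma> q\<bar> \<le> 1" and Y: "\<And>P x u. \<bar>Y P x u\<bar> \<le> 1"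
    and \<eta>: "\<And>\<mu>. t \<le> \<mu> \<Longrightarrow> \<mu> \<le> 1 \<Longrightarrow>
      \<mu> powr ((1 + \<zeta>) / (1 + \<tau>\<^sup>2 * \<zeta>)) * (\<kappa> * \<mu>) powr (- \<zeta>) \<le> \<eta> * \<mu>"
  shows "(\<Sum>P\<in>datasets C n. ave (\<lambda>x. \<Sum>i<n. \<epsilon> x i *
        (\<Sum>q\<in>C. noise_kernel \<delta> (P ! i) q * \<sigma> q * (Y P x (e1 q) * Y P x (e2 q)))))
      / real (card C) ^ n
    \<le> real n * (real (card V) * t + 2 * \<eta>) + real n * (real (card V) * exp (- 2 * real n / \<kappa>))
      + \<theta> * (1 + real (card V) * (4 * (4 * real n) * 2 ^ Suc h * \<kappa> * 2\<^sup>2 / \<theta>\<^sup>2) ^ (2 ^ h))"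
    (is "?lhs \<le> _ + _ + ?R")
proof -
  have finC: "finite C" and neC: "C \<noteq> {}" and cardC: "real (card C) = 2 ^ d" "0 < real (card C)"
    by (auto simp: C_def finite_hamming_cube hamming_cube_nonempty card_hamming_cube)
  have \<delta>: "0 \<le> \<delta>" "\<delta> \<le> 1" using \<tau> by auto
  define W where "W = noise_kernel \<delta>"
  have W: "0 \<le> W p q" for p q by (simp add: W_def noise_kernel_nonneg)
  have Wrow: "(\<Sum>q\<in>C. W p q) = 1" if "p \<in> C" for p
    using that unfolding W_def C_def by (rule noise_kernel_row_sum)
  have Wcol: "(\<Sum>p\<in>C. W p q) = 1" if "q \<in> C" for q
    using \<delta> that unfolding W_def C_def by (rule noise_kernel_column_sum)
  define A where "A u = {q. q \<in> C \<and> u \<in> {e1 q, e2 q}}" for u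
  define \<mu> where "\<mu> u = real (card (A u)) / 2 ^ d" for u
  define f where "f u p = noisy_mass \<delta> (A u) p" for u p
  define V' where "V' = {u \<in> V. t \<le> \<mu> u}"
  \<comment> \<open>Excludes the rarely probed cells, and those data points whose own mass in the
    cell is too large compared with the average.\<close>
  define ok where "ok u p \<longleftrightarrow> u \<in> V' \<and> f u p \<le> \<kappa> * \<mu> u" for u p
  define a where "a p q = (if ok (e1 q) p \<and> ok (e2 q) p then W p q else 0)" for p q
  define b where "b p = (\<Sum>q\<in>C. W p q - a p q)" for p
  \<comment> \<open>Truncation makes \<open>g\<close> bounded by \<open>\<kappa> * \<mu> u\<close>,
    as the Chernoff bound requires. It still dominates the kept mass, which vanishes wherever
    \<open>f u p\<close> is too large.\<close>
  define g where "g u p = (if f u p \<le> \<kappa> * \<mu> u then f u p else 0)" for u p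
  have A: "A u \<subseteq> C" "finite (A u)" for u using finC by (auto simp: A_def)
  have f0: "0 \<le> f u p" for u p by (simp add: f_def noisy_mass_nonneg)
  have f_sum: "f u p = (\<Sum>q\<in>A u. W p q)" for u p by (simp add: f_def noisy_mass_def W_def)
  have \<mu>1: "\<mu> u \<le> 1" for u
    using card_mono[OF finC A(1)[of u]] cardC by (simp add: \<mu>_def)
  have sum_f: "(\<Sum>p\<in>C. f u p) = real (card C) * \<mu> u" for u
  proof -
    have "(\<Sum>p\<in>C. f u p) = (\<Sum>q\<in>A u. \<Sum>p\<in>C. W p q)"
      unfolding f_sum by (rule sum.swap)
    also have "\<dots> = (\<Sum>q\<in>A u. 1)" using Wcol A by (intro sum.cong) auto
    finally show ?thesis by (simp add: \<mu>_def cardC)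
  qed
  \<comment> \<open>Double counting: every query probes at most two cells.\<close>
  have sum_\<mu>: "(\<Sum>u\<in>U. \<mu> u) \<le> 2" if "U \<subseteq> V" for U
  proof -
    have finU: "finite U" using that V finite_subset by blast
    have "(\<Sum>u\<in>U. real (card (A u))) = (\<Sum>u\<in>U. \<Sum>q\<in>C. if u \<in> {e1 q, e2 q} then 1 else 0)"
      using finC by (intro sum.cong refl) (simp add: A_def sum.inter_filter[symmetric])
    also have "\<dots> = (\<Sum>q\<in>C. \<Sum>u\<in>U. if u \<in> {e1 q, e2 q} then 1 else 0)" by (rule sum.swap)
    also have "\<dots> \<le> (\<Sum>q\<in>C. 2)"
    proof (rule sum_mono)
      fix q
      have "(\<Sum>u\<in>U. if u \<in> {e1 q, e2 q} then 1 else 0 :: real) = real (card {u \<in> U. u \<in> {e1 q, e2 q}})"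
        using finU by (simp add: sum.inter_filter[symmetric])
      also have "\<dots> \<le> real (card {e1 q, e2 q})" by (intro of_nat_mono card_mono) auto
      also have "\<dots> \<le> 2" by (simp add: card_insert_if)
      finally show "(\<Sum>u\<in>U. if u \<in> {e1 q, e2 q} then 1 else 0 :: real) \<le> 2" .
    qed
    finally show ?thesis using cardC by (simp add: \<mu>_def sum_divide_distrib[symmetric] field_simps)
  qed
  have V': "finite V'" "V' \<subseteq> V" "card V' \<le> card V"
    using V by (auto simp: V'_def intro: card_mono)
  have \<mu>pos: "0 < \<mu> u" if "u \<in> V'" for u using that pos by (simp add: V'_def)
  have a: "0 \<le> a p q" "a p q \<le> W p q" for p q using W by (auto simp: a_def)

  have b_mean: "(\<Sum>p\<in>C. b p) / real (card C) \<le> real (card V) * t + 2 * \<eta>"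
  proof -
    \<comment> \<open>A discarded query is charged to a cell that is not \<open>ok\<close>. Averaged
      over the data points, a rare cell is charged \<open>\<mu> u \<le> t\<close> and any other cell
      the tail of its noisy mass, at most \<open>\<eta> * \<mu> u\<close>.\<close>
    have "W p q - a p q \<le> (\<Sum>u\<in>V. if q \<in> A u \<and> \<not> ok u p then W p q else 0)" if "q \<in> C" for p q
    proof -
      have nn: "0 \<le> (\<Sum>u\<in>V. if q \<in> A u \<and> \<not> ok u p then W p q else 0)"
        using W by (intro sum_nonneg) auto
      show ?thesis
      proof (cases "ok (e1 q) p \<and> ok (e2 q) p")
        case True
        thus ?thesis using nn by (simp add: a_def)
      next
        case False
        then obtain u where u: "u \<in> {e1 q, e2 q}" "\<not> ok u p" by auto
        have "(if q \<in> A u \<and> \<not> ok u p then W p q else 0) \<le> (\<Sum>u\<in>V. if q \<in> A u \<and> \<not> ok u p then W p q else 0)"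
          using u e[OF that] V W by (intro member_le_sum) auto
        moreover have "q \<in> A u" using u that by (simp add: A_def)
        ultimately show ?thesis using u False by (auto simp: a_def)
      qed
    qed
    hence "(\<Sum>p\<in>C. b p) \<le> (\<Sum>p\<in>C. \<Sum>q\<in>C. \<Sum>u\<in>V. if q \<in> A u \<and> \<not> ok u p then W p q else 0)"
      unfolding b_def by (intro sum_mono) auto
    also have "\<dots> = (\<Sum>p\<in>C. \<Sum>u\<in>V. \<Sum>q\<in>C. if q \<in> A u \<and> \<not> ok u p then W p q else 0)"
      by (intro sum.cong refl sum.swap)
    also have "\<dots> = (\<Sum>p\<in>C. \<Sum>u\<in>V. if \<not> ok u p then f u p else 0)"
    proof (intro sum.cong refl)
      fix p u
      show "(\<Sum>q\<in>C. if q \<in> A u \<and> \<not> ok u p then W p q else 0) = (if \<not> ok u p then f u p else 0)"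
        using sum.inter_restrict[OF finC, of "W p" "A u"] A(1)[of u] by (auto simp: f_sum Int_absorb1)
    qed
    also have "\<dots> = (\<Sum>u\<in>V. \<Sum>p\<in>C. if \<not> ok u p then f u p else 0)" by (rule sum.swap)
    also have "\<dots> \<le> (\<Sum>u\<in>V. real (card C) * (t + \<eta> * \<mu> u))"
    proof (rule sum_mono)
      fix u assume u: "u \<in> V"
      show "(\<Sum>p\<in>C. if \<not> ok u p then f u p else 0) \<le> real (card C) * (t + \<eta> * \<mu> u)"
      proof (cases "u \<in> V'")
        case False
        hence "(\<Sum>p\<in>C. if \<not> ok u p then f u p else 0) = real (card C) * \<mu> u"
          by (simp add: ok_def sum_f)
        moreover have "\<mu> u \<le> t" using False u by (simp add: V'_def)
        moreover have "0 \<le> \<eta> * \<mu> u" using pos by (simp add: \<mu>_def)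
        ultimately show ?thesis by (simp add: mult_left_mono)
      next
        case True
        have "A u \<noteq> {}" using \<mu>pos[OF True] by (auto simp: \<mu>_def)
        have "(\<Sum>p\<in>C. if \<not> ok u p then f u p else 0) = (\<Sum>p | p \<in> C \<and> \<kappa> * \<mu> u < f u p. f u p)"
          using finC True by (simp add: ok_def not_le sum.inter_filter[symmetric])
        also have "\<dots> / 2 ^ d \<le> \<mu> u powr ((1 + \<zeta>) / (1 + \<tau>\<^sup>2 * \<zeta>)) * (\<kappa> * \<mu> u) powr (- \<zeta>)"
          using A(1)[of u] \<open>A u \<noteq> {}\<close> unfolding f_def \<mu>_def C_def
          by (intro noisy_mass_tail \<tau> \<zeta> pos)
        also have "\<dots> \<le> \<eta> * \<mu> u" using True by (intro \<eta> \<mu>1) (simp add: V'_def)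
        finally have "(\<Sum>p\<in>C. if \<not> ok u p then f u p else 0) \<le> real (card C) * (\<eta> * \<mu> u)"
          by (simp add: cardC field_simps)
        also have "\<dots> \<le> real (card C) * (t + \<eta> * \<mu> u)" using pos by (intro mult_left_mono) auto
        finally show ?thesis .
      qed
    qed
    also have "\<dots> = real (card C) * (real (card V) * t + \<eta> * (\<Sum>u\<in>V. \<mu> u))"
      by (simp add: sum_distrib_left[symmetric] sum.distrib)
    also have "\<dots> \<le> real (card C) * (real (card V) * t + \<eta> * 2)"
      using pos sum_\<mu>[of V] by (intro mult_left_mono add_left_mono) auto
    finally show ?thesis using cardC(2) by (simp add: field_simps)
  qed

  \<comment> \<open>A condition on the data points alone, so for a fixed typical dataset the bits
    are still uniform signs.\<close>
  define typical where "typical P \<longleftrightarrow> (\<forall>u\<in>V'. (\<Sum>i<n. g u (P ! i)) \<le> 4 * real n * \<mu> u)" for P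
  define atypical where "atypical = {P \<in> datasets C n. \<not> typical P}"
  have card_atypical: "real (card atypical) \<le> real (card C) ^ n * (real (card V) * exp (- 2 * real n / \<kappa>))"
  proof -
    define Bad where "Bad u = {P \<in> datasets C n. 4 * real n < (\<Sum>i<n. g u (P ! i) / \<mu> u)}" for u
    have "atypical \<subseteq> (\<Union>u\<in>V'. Bad u)"
      using \<mu>pos by (auto simp: atypical_def typical_def Bad_def sum_divide_distrib[symmetric] field_simps not_le)
    hence "card atypical \<le> card (\<Union>u\<in>V'. Bad u)"
      using V' finite_datasets[OF finC] by (intro card_mono) (auto simp: Bad_def)
    also have "\<dots> \<le> (\<Sum>u\<in>V'. card (Bad u))" using V' by (intro card_UN_le)
    finally have "real (card atypical) \<le> (\<Sum>u\<in>V'. real (card (Bad u)))"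
      by (simp flip: of_nat_sum)
    also have "\<dots> \<le> (\<Sum>u\<in>V'. real (card C) ^ n * exp (- 2 * real n / \<kappa>))"
    proof (rule sum_mono)
      fix u assume u: "u \<in> V'"
      have "(\<Sum>p\<in>C. g u p / \<mu> u) \<le> (\<Sum>p\<in>C. f u p / \<mu> u)"
        using \<mu>pos[OF u] f0 by (intro sum_mono divide_right_mono) (auto simp: g_def)
      also have "\<dots> = real (card C)"
        using \<mu>pos[OF u] by (simp add: sum_divide_distrib[symmetric] sum_f)
      finally have mean: "(\<Sum>p\<in>C. g u p / \<mu> u) \<le> real (card C)" .
      have "0 \<le> g u p / \<mu> u" "g u p / \<mu> u \<le> \<kappa>" for p
        using \<mu>pos[OF u] f0 pos by (auto simp: g_def field_simps)
      thus "real (card (Bad u)) \<le> real (card C) ^ n * exp (- 2 * real n / \<kappa>)"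
        unfolding Bad_def by (intro card_datasets_large_sum finC neC pos mean)
    qed
    also have "\<dots> \<le> real (card C) ^ n * (real (card V) * exp (- 2 * real n / \<kappa>))"
      using V'(3) by (simp add: mult.left_commute mult_left_mono mult_right_mono)
    finally show ?thesis .
  qed

  define corr where "corr P x = (\<Sum>i<n. \<epsilon> x i * (\<Sum>q\<in>C. W (P ! i) q * \<sigma> q * (Y P x (e1 q) * Y P x (e2 q))))" for P x
  have \<epsilon>: "\<bar>\<epsilon> x i\<bar> = 1" if "x \<in> X" "i < n" for x i
    using sign_square[OF that] by (metis abs_mult abs_of_nonneg abs_one abs_square_eq_1 power2_eq_square)
  have YY: "\<bar>\<sigma> q * (Y P x (e1 q) * Y P x (e2 q))\<bar> \<le> 1" for P x q
  proof -
    have "\<bar>Y P x (e1 q)\<bar> * \<bar>Y P x (e2 q)\<bar> \<le> 1 * 1" by (rule mult_mono[OF Y Y]) auto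
    hence "\<bar>\<sigma> q\<bar> * (\<bar>Y P x (e1 q)\<bar> * \<bar>Y P x (e2 q)\<bar>) \<le> 1 * 1" by (intro mult_mono[OF \<sigma>]) auto
    thus ?thesis by (simp add: abs_mult)
  qed
  \<comment> \<open>The trivial bound by the total weight, applied to the whole kernel on atypical
    datasets and to the discarded part on typical ones.\<close>
  have weigh: "\<bar>\<Sum>i<n. \<epsilon> x i * (\<Sum>q\<in>C. w i q * \<sigma> q * (Y P x (e1 q) * Y P x (e2 q)))\<bar> \<le> (\<Sum>i<n. \<Sum>q\<in>C. w i q)"
    if x: "x \<in> X" and w: "\<And>i q. 0 \<le> w i q" for x P w
  proof (rule order_trans[OF sum_abs], rule sum_mono)
    fix i assume i: "i \<in> {..<n}"
    have "\<bar>\<Sum>q\<in>C. w i q * \<sigma> q * (Y P x (e1 q) * Y P x (e2 q))\<bar> \<le> (\<Sum>q\<in>C. w i q)"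
    proof (rule order_trans[OF sum_abs], rule sum_mono)
      fix q
      have "\<bar>w i q * \<sigma> q * (Y P x (e1 q) * Y P x (e2 q))\<bar> = w i q * \<bar>\<sigma> q * (Y P x (e1 q) * Y P x (e2 q))\<bar>"
        using w by (simp add: abs_mult)
      also have "\<dots> \<le> w i q * 1" by (intro mult_left_mono YY w)
      finally show "\<bar>w i q * \<sigma> q * (Y P x (e1 q) * Y P x (e2 q))\<bar> \<le> w i q" by simp
    qed
    thus "\<bar>\<epsilon> x i * (\<Sum>q\<in>C. w i q * \<sigma> q * (Y P x (e1 q) * Y P x (e2 q)))\<bar> \<le> (\<Sum>q\<in>C. w i q)"
      using \<epsilon>[OF x] i by (simp add: abs_mult)
  qed
  have R0: "0 \<le> ?R" using pos by (intro mult_nonneg_nonneg add_nonneg_nonneg zero_le_power) auto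
  have b0: "0 \<le> b p" for p unfolding b_def using a by (intro sum_nonneg) simp

  have atypical_le: "ave (corr P) \<le> real n" if P: "P \<in> datasets C n" for P
  proof -
    have "corr P x \<le> real n" if x: "x \<in> X" for x
    proof -
      have "corr P x \<le> (\<Sum>i<n. \<Sum>q\<in>C. W (P ! i) q)"
        using weigh[OF x, of "\<lambda>i. W (P ! i)" P] W unfolding corr_def by (simp add: abs_le_iff)
      also have "\<dots> = (\<Sum>i<n. 1)"
        using P by (intro sum.cong refl Wrow) (auto simp: datasets_def)
      finally show ?thesis by simp
    qed
    thus ?thesis using ave_mono[of "corr P" "\<lambda>x. real n"] by (simp add: ave_const)
  qed
  have typical_le: "ave (corr P) \<le> ?R + (\<Sum>i<n. b (P ! i))" if P: "typical P" for P
  proof -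
    \<comment> \<open>The moment bound divides by square roots of \<mu>, so both cells of a query
      have to lie in \<open>V'\<close>; for all other queries \<open>a\<close> is zero.\<close>
    define Q where "Q = {q \<in> C. e1 q \<in> V' \<and> e2 q \<in> V'}"
    have Q: "finite Q" "Q \<subseteq> C" using finC by (auto simp: Q_def)
    define main where "main x = (\<Sum>i<n. \<epsilon> x i * (\<Sum>q\<in>Q. a (P ! i) q * \<sigma> q * (Y P x (e1 q) * Y P x (e2 q))))" for x
    have "corr P x \<le> \<bar>main x\<bar> + (\<Sum>i<n. b (P ! i))" if x: "x \<in> X" for x
    proof -
      have "(\<Sum>q\<in>Q. a (P ! i) q * \<sigma> q * (Y P x (e1 q) * Y P x (e2 q)))
        = (\<Sum>q\<in>C. a (P ! i) q * \<sigma> q * (Y P x (e1 q) * Y P x (e2 q)))" for i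
        using Q finC by (intro sum.mono_neutral_left) (auto simp: Q_def a_def ok_def)
      hence "corr P x - main x = (\<Sum>i<n. \<epsilon> x i * (\<Sum>q\<in>C. (W (P ! i) q - a (P ! i) q) * \<sigma> q * (Y P x (e1 q) * Y P x (e2 q))))"
        by (simp add: corr_def main_def sum_subtractf left_diff_distrib right_diff_distrib)
      also have "\<dots> \<le> (\<Sum>i<n. b (P ! i))"
        using weigh[OF x, of "\<lambda>i q. W (P ! i) q - a (P ! i) q" P] a unfolding b_def
        by (simp add: abs_le_iff)
      finally show ?thesis by simp
    qed
    hence "ave (corr P) \<le> ave (\<lambda>x. \<bar>main x\<bar> + (\<Sum>i<n. b (P ! i)))" by (rule ave_mono)
    also have "\<dots> = ave (\<lambda>x. \<bar>main x\<bar>) + (\<Sum>i<n. b (P ! i))" by (simp only: ave_add ave_const)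
    also have "ave (\<lambda>x. \<bar>main x\<bar>)
      \<le> \<theta> * (1 + real (card V') * (4 * (4 * real n) * 2 ^ Suc h * \<kappa> * 2\<^sup>2 / \<theta>\<^sup>2) ^ (2 ^ h))"
    proof -
      have row: "(\<Sum>q | q \<in> Q \<and> u \<in> {e1 q, e2 q}. a p q) \<le> g u p" for p u
      proof (cases "f u p \<le> \<kappa> * \<mu> u")
        case True
        have "(\<Sum>q | q \<in> Q \<and> u \<in> {e1 q, e2 q}. a p q) \<le> (\<Sum>q | q \<in> Q \<and> u \<in> {e1 q, e2 q}. W p q)"
          using a by (intro sum_mono) auto
        also have "\<dots> \<le> f u p"
          unfolding f_sum using A W Q by (intro sum_mono2) (auto simp: A_def)
        finally show ?thesis using True by (simp add: g_def)
      next
        case False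
        have "(\<Sum>q | q \<in> Q \<and> u \<in> {e1 q, e2 q}. a p q) = 0"
          using False by (intro sum.neutral) (auto simp: a_def ok_def)
        thus ?thesis using False by (simp add: g_def)
      qed
      show ?thesis unfolding main_def
      proof (rule two_query_ave_le[where \<mu> = \<mu>])
        fix i u assume "u \<in> V'"
        have "g u (P ! i) \<le> \<kappa> * \<mu> u" using \<mu>pos[OF \<open>u \<in> V'\<close>] pos by (simp add: g_def)
        with row[where u = u and p = "P ! i"] show "(\<Sum>q | q \<in> Q \<and> u \<in> {e1 q, e2 q}. a (P ! i) q) \<le> \<kappa> * \<mu> u" by linarith
      next
        fix u assume "u \<in> V'"
        have "(\<Sum>i<n. \<Sum>q | q \<in> Q \<and> u \<in> {e1 q, e2 q}. a (P ! i) q) \<le> (\<Sum>i<n. g u (P ! i))"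
          by (intro sum_mono row)
        also have "\<dots> \<le> 4 * real n * \<mu> u" using P \<open>u \<in> V'\<close> by (simp add: typical_def)
        finally show "(\<Sum>i<n. \<Sum>q | q \<in> Q \<and> u \<in> {e1 q, e2 q}. a (P ! i) q) \<le> 4 * real n * \<mu> u" .
      qed (use V' Q \<mu>pos sum_\<mu>[OF V'(2)] a \<sigma> Y pos in \<open>auto simp: Q_def\<close>)
    qed
    also have "\<dots> \<le> ?R"
      using V'(3) pos by (intro mult_left_mono add_left_mono mult_right_mono) auto
    finally show ?thesis by simp
  qed

  have "(\<Sum>P\<in>datasets C n. ave (corr P))
    \<le> (\<Sum>P\<in>datasets C n. (?R + (\<Sum>i<n. b (P ! i))) + (if P \<in> atypical then real n else 0))"
  proof (rule sum_mono)
    fix P assume P: "P \<in> datasets C n"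
    show "ave (corr P) \<le> (?R + (\<Sum>i<n. b (P ! i))) + (if P \<in> atypical then real n else 0)"
    proof (cases "typical P")
      case True
      thus ?thesis using typical_le[OF True] by (simp add: atypical_def)
    next
      case False
      have "0 \<le> (\<Sum>i<n. b (P ! i))" by (intro sum_nonneg b0)
      with False R0 atypical_le[OF P] P show ?thesis by (simp add: atypical_def)
    qed
  qed
  also have "\<dots> = real (card C) ^ n * ?R + (\<Sum>P\<in>datasets C n. \<Sum>i<n. b (P ! i)) + real n * real (card atypical)"
  proof -
    have "(\<Sum>P\<in>datasets C n. if P \<in> atypical then real n else 0) = real n * real (card atypical)"
      using sum.inter_restrict[OF finite_datasets[OF finC, of n], of "\<lambda>_. real n" atypical]
      by (simp add: atypical_def Int_absorb1 mult.commute Int_def conj_left_absorb)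
    thus ?thesis by (simp add: sum.distrib card_datasets[OF finC])
  qed
  also have "(\<Sum>P\<in>datasets C n. \<Sum>i<n. b (P ! i)) = real (card C) ^ n * (real n * ((\<Sum>p\<in>C. b p) / real (card C)))"
    by (rule sum_datasets_sum[OF finC neC])
  also have "\<dots> \<le> real (card C) ^ n * (real n * (real (card V) * t + 2 * \<eta>))"
    using b_mean by (intro mult_left_mono) auto
  also have "real n * real (card atypical) \<le> real n * (real (card C) ^ n * (real (card V) * exp (- 2 * real n / \<kappa>)))"
    using card_atypical by (intro mult_left_mono) auto
  finally have "(\<Sum>P\<in>datasets C n. ave (corr P))
    \<le> real (card C) ^ n * (real n * (real (card V) * t + 2 * \<eta>)
        + real n * (real (card V) * exp (- 2 * real n / \<kappa>)) + ?R)"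
    by (simp add: algebra_simps)
  thus ?thesis
    using cardC(2) unfolding corr_def W_def by (simp add: divide_le_eq mult.commute)
qed

end

section \<open>Two-probe algorithms\<close>

lemma finite_cells_read: "finite (cells_read g T)"
  by (induction g) auto

lemma run_alg_cong:
  assumes "\<And>a. a \<in> cells_read g T \<Longrightarrow> T' a = T a"
  shows "run_alg g T' = run_alg g T \<and> cells_read g T' = cells_read g T"
  using assms
proof (induction g)
  case (Probe a k)
  have "T' a = T a" using Probe.prems by simp
  thus ?case using Probe.IH[of "k (T a)"] Probe.prems by auto
qed simp

text \<open>The cell \<open>a\<close> counts as already read, with content \<open>z\<close>.
  Repeated probes of it are resolved by following the branch \<open>k z\<close>; the first fresh
  address is then determined by the tree and \<open>z\<close> alone, and it exhausts the
  budget.\<close>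

lemma second_probe_normal_form:
  "\<exists>b F. \<forall>T. T a = z \<longrightarrow> card (insert a (cells_read g T)) \<le> 2 \<longrightarrow> run_alg g T = F (T b)"
proof (induction g)
  case (Answer c)
  show ?case by (rule exI[of _ 0], rule exI[of _ "\<lambda>_. c"]) simp
next
  case (Probe b k)
  show ?case
  proof (cases "b = a")
    case True
    obtain b' F where "\<And>T. T a = z \<Longrightarrow> card (insert a (cells_read (k z) T)) \<le> 2 \<Longrightarrow> run_alg (k z) T = F (T b')"
      using Probe[of "k z"] by blast
    thus ?thesis using True by (intro exI[of _ b'] exI[of _ F]) simp
  next
    case False
    \<comment> \<open>After \<open>b\<close> only \<open>a\<close> and \<open>b\<close> can be read,
      so a table with \<open>z\<close> at \<open>a\<close> and \<open>y\<close> everywhere else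
      simulates the rest of the run.\<close>
    define F where "F y = run_alg (k y) (\<lambda>c. if c = a then z else y)" for y
    have "run_alg (Probe b k) T = F (T b)"
      if T: "T a = z" "card (insert a (cells_read (Probe b k) T)) \<le> 2" for T
    proof -
      have "{a, b} \<subseteq> insert a (cells_read (Probe b k) T)" "card {a, b} = 2"
        using False by auto
      hence "{a, b} = insert a (cells_read (Probe b k) T)"
        using T(2) by (intro card_seteq) (simp_all add: finite_cells_read)
      hence "(if c = a then z else T b) = T c" if "c \<in> cells_read (k (T b)) T" for c
        using that T(1) by auto
      hence "run_alg (k (T b)) (\<lambda>c. if c = a then z else T b) = run_alg (k (T b)) T"
        by (intro conjunct1[OF run_alg_cong])
      thus ?thesis by (simp add: F_def)
    qed
    thus ?thesis by blast
  qed
qed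

text \<open>The second address depends on the table only through the first content, so guessing that
  content removes the adaptivity. Addresses that the run does not read are arbitrary, such as the
  filler 0.\<close>

lemma two_probe_normal_form:
  "\<exists>a b F. \<forall>T. card (cells_read g T) \<le> 2 \<longrightarrow> run_alg g T = F (T a) (T (b (T a)))"
proof (cases g)
  case (Answer c)
  show ?thesis
    by (rule exI[of _ 0], rule exI[of _ "\<lambda>_. 0"], rule exI[of _ "\<lambda>_ _. c"]) (simp add: Answer)
next
  case (Probe a k)
  have "\<forall>z. \<exists>b F. \<forall>T. T a = z \<longrightarrow> card (insert a (cells_read (k z) T)) \<le> 2 \<longrightarrow> run_alg (k z) T = F (T b)"
    using second_probe_normal_form by blast
  then obtain b F where "\<And>z T. T a = z \<Longrightarrow> card (insert a (cells_read (k z) T)) \<le> 2 \<Longrightarrow> run_alg (k z) T = F z (T (b z))"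
    by metis
  thus ?thesis by (intro exI[of _ a] exI[of _ b] exI[of _ F]) (simp add: Probe)
qed

section \<open>The bits as random signs, and their correlation with the answers\<close>

definition bool_sign :: "bool \<Rightarrow> real" where
  "bool_sign b = (if b then 1 else -1)"

lemma bool_sign_Not: "bool_sign (\<not> b) = - bool_sign b"
  by (simp add: bool_sign_def)

definition bit_strings :: "nat \<Rightarrow> bool list set" where
  "bit_strings n = {x. length x = n}"

lemma finite_bit_strings: "finite (bit_strings n)"
  and card_bit_strings: "card (bit_strings n) = 2 ^ n"
  using finite_lists_length_eq[of "UNIV :: bool set" n] card_lists_length_eq[of "UNIV :: bool set" n]
  by (auto simp: bit_strings_def)

lemma bit_strings_nonempty: "bit_strings n \<noteq> {}"
  by (auto simp: bit_strings_def intro!: exI[of _ "replicate n True"])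

lemma random_signs_bit_strings: "random_signs (bit_strings n) (\<lambda>x i. bool_sign (x ! i)) n"
proof
  show "finite (bit_strings n)" "bit_strings n \<noteq> {}"
    by (rule finite_bit_strings, rule bit_strings_nonempty)
  show "bool_sign (x ! i) * bool_sign (x ! i) = 1" for x i by (simp add: bool_sign_def)
next
  fix A assume A: "A \<subseteq> {..<n}" "A \<noteq> {}"
  then obtain i where i: "i \<in> A" "i < n" by auto
  have finA: "finite A" using A finite_subset by blast
  define f where "f x = (\<Prod>i\<in>A. bool_sign (x ! i))" for x
  \<comment> \<open>Flipping bit \<open>i\<close> is an involution on the bit strings that negates
    every product containing index \<open>i\<close>, so the sum equals its own negative.\<close>
  have neg: "f (x[i := \<not> x ! i]) = - f x" if "x \<in> bit_strings n" for x
  proof -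
    have "f (x[i := \<not> x ! i]) = bool_sign (\<not> x ! i) * (\<Prod>j\<in>A - {i}. bool_sign (x[i := \<not> x ! i] ! j))"
      using that i finA by (simp add: f_def prod.remove bit_strings_def)
    also have "(\<Prod>j\<in>A - {i}. bool_sign (x[i := \<not> x ! i] ! j)) = (\<Prod>j\<in>A - {i}. bool_sign (x ! j))"
      by (intro prod.cong refl) auto
    finally show ?thesis using i finA by (simp add: f_def prod.remove bool_sign_Not)
  qed
  have "(\<Sum>x\<in>bit_strings n. f x) = (\<Sum>x\<in>bit_strings n. f (x[i := \<not> x ! i]))"
    by (rule sum.reindex_bij_witness[of _ "\<lambda>x. x[i := \<not> x ! i]" "\<lambda>x. x[i := \<not> x ! i]"])
      (use i in \<open>auto simp: bit_strings_def\<close>)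
  also have "\<dots> = - (\<Sum>x\<in>bit_strings n. f x)" by (simp add: neg sum_negf)
  finally show "(\<Sum>x\<in>bit_strings n. \<Prod>i\<in>A. bool_sign (x ! i)) = 0" by (simp add: f_def)
qed

interpretation bits: random_signs "bit_strings n" "\<lambda>x i. bool_sign (x ! i)" n for n
  by (rule random_signs_bit_strings)

text \<open>Averaged over datasets and bits, but summed over the index: the value is
  \<open>n\<close> if the answer always equals the bit of the sampled point, and 0 for answers
  independent of that bit.\<close>

definition answer_correlation :: "nat \<Rightarrow> nat \<Rightarrow> real \<Rightarrow> data_structure \<Rightarrow> real" where
  "answer_correlation n d \<delta> D = (\<Sum>P\<in>datasets (hamming_cube d) n.
      bits.ave n (\<lambda>x. \<Sum>i<n. bool_sign (x ! i) * (\<Sum>q\<in>hamming_cube d.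
        noise_kernel \<delta> (P ! i) q * bool_sign (run_alg (snd D q) (fst D P x)))))
    / real (card (hamming_cube d)) ^ n"

text \<open>
  Guessing the contents \<open>z\<close> and \<open>y\<close> of the two cells turns an adaptive algorithm into \<open>4 ^ w\<close>
  bilinear forms in the indicators of \<open>z\<close> and \<open>y\<close>; the address \<open>m\<close> stands for all cells outside
  the table.
\<close>

lemma answer_correlation_le:
  fixes \<delta> B :: real
  assumes D: "cell_probe_data_structure n d m w 2 D"
    and B: "\<And>\<sigma> e1 e2 (Y :: int list list \<Rightarrow> bool list \<Rightarrow> bool \<times> nat \<Rightarrow> real).
      (\<And>q. \<bar>\<sigma> q\<bar> \<le> 1) \<Longrightarrow> (\<And>q. q \<in> hamming_cube d \<Longrightarrow> e1 q \<in> UNIV \<times> {..m}) \<Longrightarrow>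
      (\<And>q. q \<in> hamming_cube d \<Longrightarrow> e2 q \<in> UNIV \<times> {..m}) \<Longrightarrow> (\<And>P x u. \<bar>Y P x u\<bar> \<le> 1) \<Longrightarrow>
      (\<Sum>P\<in>datasets (hamming_cube d) n. bits.ave n (\<lambda>x. \<Sum>i<n. bool_sign (x ! i) *
        (\<Sum>q\<in>hamming_cube d. noise_kernel \<delta> (P ! i) q * \<sigma> q * (Y P x (e1 q) * Y P x (e2 q)))))
      / real (card (hamming_cube d)) ^ n \<le> B"
  shows "answer_correlation n d \<delta> D \<le> 4 ^ w * B"
proof -
  define L where "L = bit_strings w"
  have finL: "finite L" by (simp add: L_def finite_bit_strings)
  obtain a b F where norm: "\<And>q T. card (cells_read (snd D q) T) \<le> 2 \<Longrightarrow>
      run_alg (snd D q) T = F q (T (a q)) (T (b q (T (a q))))"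
    using two_probe_normal_form[of "snd D _"] by metis
  \<comment> \<open>The normal form may name addresses that are not read and lie outside the table.
    A fixed string of length \<open>w\<close> there keeps every content among the guesses in
    \<open>L\<close> and lets one address represent them all.\<close>
  define T where "T P x c = (if c < m then fst D P x c else replicate w False)" for P x c
  define Y where "Y z y P x u = (of_bool (T P x (snd u) = (if fst u then y else z)) :: real)"
    for z y :: "bool list" and P and x :: "bool list" and u :: "bool \<times> nat"
  \<comment> \<open>Each cell occurs in two copies tagged by a boolean, one for the indicator of
    \<open>z\<close> and one for that of \<open>y\<close>, so that a single vector serves both
    probes even when they hit the same cell.\<close>
  define e1 where "e1 q = (False, min (a q) m)" for q
  define e2 where "e2 z q = (True, min (b q z) m)" for z q
  have clamp: "T P x (min c m) = T P x c" for P x c by (simp add: T_def min_def)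
  have expand: "bool_sign (run_alg (snd D q) (fst D P x))
    = (\<Sum>z\<in>L. \<Sum>y\<in>L. bool_sign (F q z y) * (Y z y P x (e1 q) * Y z y P x (e2 z q)))"
    if P: "P \<in> datasets (hamming_cube d) n" and x: "x \<in> bit_strings n" and q: "q \<in> hamming_cube d" for P x q
  proof -
    have valid: "\<And>c. c < m \<Longrightarrow> length (fst D P x c) = w"
      "cells_read (snd D q) (fst D P x) \<subseteq> {..<m}" "card (cells_read (snd D q) (fst D P x)) \<le> 2"
      using D P x q by (auto simp: cell_probe_data_structure_def datasets_def bit_strings_def)
    have TL: "T P x c \<in> L" for c using valid(1) by (simp add: T_def L_def bit_strings_def)
    have "T P x c = fst D P x c" if "c \<in> cells_read (snd D q) (fst D P x)" for c
      using that valid(2) by (auto simp: T_def)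
    hence "run_alg (snd D q) (T P x) = run_alg (snd D q) (fst D P x)
      \<and> cells_read (snd D q) (T P x) = cells_read (snd D q) (fst D P x)"
      by (rule run_alg_cong)
    hence "run_alg (snd D q) (fst D P x) = F q (T P x (a q)) (T P x (b q (T P x (a q))))"
      using norm[of q "T P x"] valid(3) by simp
    moreover have "(\<Sum>z\<in>L. \<Sum>y\<in>L. bool_sign (F q z y) * (Y z y P x (e1 q) * Y z y P x (e2 z q)))
      = (\<Sum>z\<in>L. if T P x (a q) = z then (\<Sum>y\<in>L. if T P x (b q z) = y then bool_sign (F q z y) else 0) else 0)"
      by (intro sum.cong refl) (auto simp: Y_def e1_def e2_def clamp intro!: sum.cong)
    ultimately show ?thesis using finL TL by simp
  qed
  have "answer_correlation n d \<delta> D = (\<Sum>P\<in>datasets (hamming_cube d) n.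
      bits.ave n (\<lambda>x. \<Sum>z\<in>L. \<Sum>y\<in>L. \<Sum>i<n. bool_sign (x ! i) * (\<Sum>q\<in>hamming_cube d.
        noise_kernel \<delta> (P ! i) q * bool_sign (F q z y) * (Y z y P x (e1 q) * Y z y P x (e2 z q)))))
    / real (card (hamming_cube d)) ^ n"
    unfolding answer_correlation_def
  proof (intro arg_cong2[of _ _ _ _ "(/)"] refl sum.cong bits.ave_cong)
    fix P x assume P: "P \<in> datasets (hamming_cube d) n" and x: "x \<in> bit_strings n"
    have "(\<Sum>i<n. bool_sign (x ! i) * (\<Sum>q\<in>hamming_cube d.
        noise_kernel \<delta> (P ! i) q * bool_sign (run_alg (snd D q) (fst D P x))))
      = (\<Sum>i<n. bool_sign (x ! i) * (\<Sum>q\<in>hamming_cube d. \<Sum>z\<in>L. \<Sum>y\<in>L.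
        noise_kernel \<delta> (P ! i) q * bool_sign (F q z y) * (Y z y P x (e1 q) * Y z y P x (e2 z q))))"
      by (intro sum.cong refl arg_cong2[of _ _ _ _ "(*)"])
        (simp add: expand[OF P x] sum_distrib_left mult.assoc)
    also have "\<dots> = (\<Sum>i<n. \<Sum>z\<in>L. \<Sum>y\<in>L. bool_sign (x ! i) * (\<Sum>q\<in>hamming_cube d.
        noise_kernel \<delta> (P ! i) q * bool_sign (F q z y) * (Y z y P x (e1 q) * Y z y P x (e2 z q))))"
      unfolding sum_distrib_left[symmetric]
      by (intro sum.cong refl arg_cong2[of _ _ _ _ "(*)"]) (subst sum.swap, subst (2) sum.swap, simp)
    also have "\<dots> = (\<Sum>z\<in>L. \<Sum>y\<in>L. \<Sum>i<n. bool_sign (x ! i) * (\<Sum>q\<in>hamming_cube d.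
        noise_kernel \<delta> (P ! i) q * bool_sign (F q z y) * (Y z y P x (e1 q) * Y z y P x (e2 z q))))"
      by (subst sum.swap, subst (2) sum.swap) simp
    finally show "(\<Sum>i<n. bool_sign (x ! i) * (\<Sum>q\<in>hamming_cube d.
        noise_kernel \<delta> (P ! i) q * bool_sign (run_alg (snd D q) (fst D P x))))
      = (\<Sum>z\<in>L. \<Sum>y\<in>L. \<Sum>i<n. bool_sign (x ! i) * (\<Sum>q\<in>hamming_cube d.
        noise_kernel \<delta> (P ! i) q * bool_sign (F q z y) * (Y z y P x (e1 q) * Y z y P x (e2 z q))))" .
  qed
  also have "\<dots> = (\<Sum>z\<in>L. \<Sum>y\<in>L. (\<Sum>P\<in>datasets (hamming_cube d) n.
      bits.ave n (\<lambda>x. \<Sum>i<n. bool_sign (x ! i) * (\<Sum>q\<in>hamming_cube d.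
        noise_kernel \<delta> (P ! i) q * bool_sign (F q z y) * (Y z y P x (e1 q) * Y z y P x (e2 z q)))))
    / real (card (hamming_cube d)) ^ n)"
    unfolding bits.ave_sum[where J = L] sum_divide_distrib[symmetric]
    by (subst sum.swap, subst (2) sum.swap) simp
  also have "\<dots> \<le> (\<Sum>z\<in>L. \<Sum>y\<in>L. B)"
    by (intro sum_mono B) (auto simp: bool_sign_def e1_def e2_def Y_def)
  also have "\<dots> = 4 ^ w * B"
    by (simp add: L_def card_bit_strings power_mult_distrib[symmetric] mult.assoc[symmetric])
  finally show ?thesis .
qed

section \<open>Success probability on the random instance\<close>

lemma pmf_replicate_pmf_of_set:
  assumes "finite C" "C \<noteq> {}" "P \<in> datasets C n"
  shows "pmf (replicate_pmf n (pmf_of_set C)) P = 1 / real (card C) ^ n"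
  using assms(3)
proof (induction n arbitrary: P)
  case 0
  thus ?case by (simp add: datasets_def)
next
  case (Suc n)
  then obtain p P' where P: "P = p # P'" "p \<in> C" "P' \<in> datasets C n"
    by (auto simp: datasets_def length_Suc_conv)
  have inj: "inj (\<lambda>(p :: 'a, P). p # P)" by (auto simp: inj_on_def)
  have "replicate_pmf (Suc n) (pmf_of_set C)
    = map_pmf (\<lambda>(p, P). p # P) (pair_pmf (pmf_of_set C) (replicate_pmf n (pmf_of_set C)))"
    by (simp add: pair_pmf_def map_pmf_def bind_assoc_pmf bind_return_pmf)
  hence "pmf (replicate_pmf (Suc n) (pmf_of_set C)) P
    = pmf (pair_pmf (pmf_of_set C) (replicate_pmf n (pmf_of_set C))) (p, P')"
    using pmf_map_inj'[OF inj, of _ "(p, P')"] by (simp add: P)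
  thus ?case using assms Suc.IH[OF P(3)] P(2) by (simp add: pmf_pair pmf_of_set)
qed

lemma expectation_hamming_random_instance:
  fixes G :: "int list list \<times> nat \<times> int list \<Rightarrow> real"
  assumes "0 < n"
  shows "measure_pmf.expectation (hamming_random_instance c n d) G
    = (\<Sum>P\<in>datasets (hamming_cube d) n. \<Sum>i<n. \<Sum>q\<in>hamming_cube d.
        noise_kernel (1 / (2 * c)) (P ! i) q * G (P, i, q)) / (real (card (hamming_cube d)) ^ n * real n)"
proof -
  define C where "C = hamming_cube d"
  have C: "finite C" "C \<noteq> {}" by (auto simp: C_def finite_hamming_cube hamming_cube_nonempty)
  define query where "query P i = flip_coords (1 / (2 * c)) (P ! i) \<bind> (\<lambda>q. return_pmf (P, i, q))"
    for P :: "int list list" and i :: nat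
  define pick where "pick P = pmf_of_set {..<n} \<bind> query P" for P
  have query: "measure_pmf.expectation (query P i) G = (\<Sum>q\<in>C. noise_kernel (1 / (2 * c)) (P ! i) q * G (P, i, q))"
    and fin_query: "finite (set_pmf (query P i))"
    if "P \<in> datasets C n" "i < n" for P i
  proof -
    have sub: "set_pmf (flip_coords (1 / (2 * c)) (P ! i)) \<subseteq> C"
      unfolding C_def by (rule set_pmf_flip_coords) (use that in \<open>auto simp: datasets_def C_def\<close>)
    show "measure_pmf.expectation (query P i) G = (\<Sum>q\<in>C. noise_kernel (1 / (2 * c)) (P ! i) q * G (P, i, q))"
      unfolding query_def by (subst pmf_expectation_bind[OF C(1) _ sub]) (auto simp: noise_kernel_def)
    show "finite (set_pmf (query P i))"
      using finite_subset[OF sub C(1)] by (simp add: query_def)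
  qed
  have pick: "measure_pmf.expectation (pick P) G = (\<Sum>i<n. \<Sum>q\<in>C. noise_kernel (1 / (2 * c)) (P ! i) q * G (P, i, q)) / real n"
    and fin_pick: "finite (set_pmf (pick P))"
    if P: "P \<in> datasets C n" for P
  proof -
    have ne: "{..<n} \<noteq> {}" using assms by auto
    have "measure_pmf.expectation (pick P) G
      = (\<Sum>i\<in>{..<n}. measure_pmf.expectation (query P i) G /\<^sub>R real (card {..<n}))"
      unfolding pick_def
      by (rule pmf_expectation_bind_pmf_of_set[OF ne finite_lessThan]) (use fin_query[OF P] in simp)
    also have "\<dots> = (\<Sum>i<n. \<Sum>q\<in>C. noise_kernel (1 / (2 * c)) (P ! i) q * G (P, i, q)) / real n"
      by (subst sum_divide_distrib, intro sum.cong refl)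
        (simp only: query[OF P] lessThan_iff card_lessThan real_scaleR_def divide_inverse mult.commute)
    finally show "measure_pmf.expectation (pick P) G
      = (\<Sum>i<n. \<Sum>q\<in>C. noise_kernel (1 / (2 * c)) (P ! i) q * G (P, i, q)) / real n" .
    show "finite (set_pmf (pick P))"
      using fin_query[OF P] ne by (auto simp: pick_def set_pmf_of_set)
  qed
  have sub: "set_pmf (replicate_pmf n (pmf_of_set C)) \<subseteq> datasets C n"
    using C by (auto simp: set_replicate_pmf datasets_def)
  have "hamming_random_instance c n d = replicate_pmf n (pmf_of_set C) \<bind> pick"
    by (simp add: hamming_random_instance_def pick_def[abs_def] query_def[abs_def] C_def)
  hence "measure_pmf.expectation (hamming_random_instance c n d) G
    = (\<Sum>P\<in>datasets C n. pmf (replicate_pmf n (pmf_of_set C)) P *\<^sub>R measure_pmf.expectation (pick P) G)"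
    using pmf_expectation_bind[OF finite_datasets[OF C(1)] _ sub, of pick G] fin_pick by simp
  also have "\<dots> = (\<Sum>P\<in>datasets C n. (\<Sum>i<n. \<Sum>q\<in>C. noise_kernel (1 / (2 * c)) (P ! i) q * G (P, i, q)))
      / (real (card C) ^ n * real n)"
    unfolding sum_divide_distrib[symmetric] sum_distrib_left[symmetric]
    by (subst sum_divide_distrib, intro sum.cong refl)
      (simp add: pmf_replicate_pmf_of_set[OF C] pick)
  finally show ?thesis by (simp add: C_def)
qed

lemma measure_bind_pmf_eq_integral:
  "measure_pmf.prob (bind_pmf M N) A = (\<integral>x. measure_pmf.prob (N x) A \<partial>M)"
proof -
  have "ennreal (measure_pmf.prob (bind_pmf M N) A) = (\<integral>\<^sup>+x. ennreal (measure_pmf.prob (N x) A) \<partial>M)"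
    unfolding measure_pmf.emeasure_eq_measure[symmetric] by (rule emeasure_bind_pmf)
  also have "\<dots> = ennreal (\<integral>x. measure_pmf.prob (N x) A \<partial>M)"
    by (intro nn_integral_eq_integral measure_pmf.integrable_const_bound[where B = 1]) auto
  finally show ?thesis by (simp add: integral_nonneg_AE)
qed

definition answer_matches :: "bool list \<Rightarrow> data_structure \<Rightarrow> (int list list \<times> nat \<times> int list) set" where
  "answer_matches x D = {(P, i, q). run_alg (snd D q) (fst D P x) = x ! i}"

text \<open>The indicator that two bits agree is \<open>1 / 2\<close> plus half the product of their
  signs, and the rows of the kernel have mass 1.\<close>

lemma ave_prob_answer_matches:
  assumes n: "0 < n" and c: "1 < c"
  shows "bits.ave n (\<lambda>x. measure_pmf.prob (hamming_random_instance c n d) (answer_matches x D))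
    = 1 / 2 + answer_correlation n d (1 / (2 * c)) D / (2 * real n)"
proof -
  define C where "C = hamming_cube d"
  define W where "W = noise_kernel (1 / (2 * c))"
  define s where "s P x q = bool_sign (run_alg (snd D q) (fst D P x))" for P x q
  have C: "finite C" "C \<noteq> {}" by (auto simp: C_def finite_hamming_cube hamming_cube_nonempty)
  have cC: "real (card C) \<noteq> 0" using C by simp
  have "measure_pmf.prob (hamming_random_instance c n d) (answer_matches x D)
    = 1 / 2 + (\<Sum>P\<in>datasets C n. \<Sum>i<n. bool_sign (x ! i) * (\<Sum>q\<in>C. W (P ! i) q * s P x q)) / (real (card C) ^ n) / (2 * real n)"
    for x
  proof -
    have "measure_pmf.prob (hamming_random_instance c n d) (answer_matches x D)
      = measure_pmf.expectation (hamming_random_instance c n d) (indicator (answer_matches x D))"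
      by simp
    also have "\<dots> = (\<Sum>P\<in>datasets C n. \<Sum>i<n. \<Sum>q\<in>C. W (P ! i) q * indicator (answer_matches x D) (P, i, q))
        / (real (card C) ^ n * real n)"
      unfolding C_def W_def by (rule expectation_hamming_random_instance[OF n])
    also have "(\<Sum>P\<in>datasets C n. \<Sum>i<n. \<Sum>q\<in>C. W (P ! i) q * indicator (answer_matches x D) (P, i, q))
      = (\<Sum>P\<in>datasets C n. \<Sum>i<n. 1 / 2 + bool_sign (x ! i) * (\<Sum>q\<in>C. W (P ! i) q * s P x q) / 2)"
    proof (intro sum.cong refl)
      fix P i assume P: "P \<in> datasets C n" and i: "i \<in> {..<n}"
      have row: "(\<Sum>q\<in>C. W (P ! i) q) = 1"
        unfolding C_def W_def by (rule noise_kernel_row_sum) (use P i in \<open>auto simp: datasets_def C_def\<close>)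
      have "(\<Sum>q\<in>C. W (P ! i) q * indicator (answer_matches x D) (P, i, q))
        = (\<Sum>q\<in>C. W (P ! i) q / 2 + bool_sign (x ! i) * (W (P ! i) q * s P x q) / 2)"
        by (intro sum.cong refl) (auto simp: answer_matches_def s_def bool_sign_def indicator_def)
      thus "(\<Sum>q\<in>C. W (P ! i) q * indicator (answer_matches x D) (P, i, q))
        = 1 / 2 + bool_sign (x ! i) * (\<Sum>q\<in>C. W (P ! i) q * s P x q) / 2"
        by (simp add: sum.distrib sum_divide_distrib[symmetric] sum_distrib_left[symmetric] row)
    qed
    also have "\<dots> = real (card C) ^ n * (real n / 2) + (\<Sum>P\<in>datasets C n. \<Sum>i<n. bool_sign (x ! i) * (\<Sum>q\<in>C. W (P ! i) q * s P x q)) / 2"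
      by (simp add: sum.distrib card_datasets[OF C(1)] sum_divide_distrib[symmetric])
    finally show ?thesis using cC n by (simp add: field_simps)
  qed
  hence "bits.ave n (\<lambda>x. measure_pmf.prob (hamming_random_instance c n d) (answer_matches x D))
    = 1 / 2 + bits.ave n (\<lambda>x. \<Sum>P\<in>datasets C n. \<Sum>i<n. bool_sign (x ! i) * (\<Sum>q\<in>C. W (P ! i) q * s P x q))
        / (real (card C) ^ n) / (2 * real n)"
    by (simp only: bits.ave_add bits.ave_const divide_inverse bits.ave_cmult mult.commute[of _ "inverse _"])
  thus ?thesis
    by (simp add: bits.ave_sum answer_correlation_def C_def W_def s_def)
qed

text \<open>Success for every \<open>x\<close> implies success on average over uniform
  \<open>x\<close>; exchanging this average with the one over \<D> leaves a bound for deterministic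
  structures. Where the promise fails for the sampled index, the answer counts as accepted, which
  costs the last summand.\<close>

lemma success_probability_le:
  fixes B :: real
  assumes n: "0 < n" and c: "1 < c"
    and \<D>: "randomized_cell_probe_data_structure n d m w 2 \<D>"
    and solves: "solves_decision_ann_on_random_instance c r c' n d prob_success \<D>"
    and B: "\<And>D. cell_probe_data_structure n d m w 2 D \<Longrightarrow> answer_correlation n d (1 / (2 * c)) D \<le> B"
  shows "prob_success \<le> 1 / 2 + B / (2 * real n)
    + (1 - measure_pmf.prob (hamming_random_instance c n d) {(P, i, q). unique_near_neighbour r c' P q i})"
proof -
  define I where "I = hamming_random_instance c n d"
  define U where "U = {(P, i, q). unique_near_neighbour r c' P q i}"
  have each: "prob_success \<le> (\<integral>D. measure_pmf.prob I (answer_matches x D) \<partial>\<D>) + (1 - measure_pmf.prob I U)"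
    if x: "x \<in> bit_strings n" for x
  proof -
    define S1 where "S1 = {(D, y). y \<in> answer_matches x D}"
    define S2 :: "(data_structure \<times> int list list \<times> nat \<times> int list) set" where "S2 = snd -` (- U)"
    have "prob_success \<le> measure_pmf.prob (pair_pmf \<D> I)
        {(D, P, i, q). decision_ann_correct r c' P x q (run_alg (snd D q) (fst D P x))}"
      using solves x by (simp add: solves_decision_ann_on_random_instance_def I_def bit_strings_def)
    also have "\<dots> \<le> measure_pmf.prob (pair_pmf \<D> I) (S1 \<union> S2)"
      by (intro measure_pmf.finite_measure_mono)
        (auto simp: S1_def S2_def U_def answer_matches_def decision_ann_correct_def)
    also have "\<dots> \<le> measure_pmf.prob (pair_pmf \<D> I) S1 + measure_pmf.prob (pair_pmf \<D> I) S2"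
      by (rule measure_Un_le) auto
    also have "measure_pmf.prob (pair_pmf \<D> I) S2 = measure_pmf.prob (map_pmf snd (pair_pmf \<D> I)) (- U)"
      by (simp only: measure_map_pmf S2_def)
    also have "\<dots> = 1 - measure_pmf.prob I U"
      by (simp add: map_snd_pair_pmf measure_pmf.prob_compl[symmetric] Compl_eq_Diff_UNIV)
    also have "measure_pmf.prob (pair_pmf \<D> I) S1 = (\<integral>D. measure_pmf.prob I (answer_matches x D) \<partial>\<D>)"
    proof -
      have "pair_pmf \<D> I = bind_pmf \<D> (\<lambda>D. map_pmf (Pair D) I)"
        by (simp add: pair_pmf_def map_pmf_def)
      thus ?thesis by (simp add: measure_bind_pmf_eq_integral S1_def vimage_def)
    qed
    finally show ?thesis .
  qed
  have int: "integrable \<D> (\<lambda>D. measure_pmf.prob I (answer_matches x D))" for x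
    by (rule measure_pmf.integrable_const_bound[where B = 1]) auto
  have "prob_success = bits.ave n (\<lambda>x. prob_success)" by (simp add: bits.ave_const)
  also have "\<dots> \<le> bits.ave n (\<lambda>x. (\<integral>D. measure_pmf.prob I (answer_matches x D) \<partial>\<D>) + (1 - measure_pmf.prob I U))"
    by (rule bits.ave_mono) (rule each)
  also have "\<dots> = bits.ave n (\<lambda>x. \<integral>D. measure_pmf.prob I (answer_matches x D) \<partial>\<D>) + (1 - measure_pmf.prob I U)"
    by (simp only: bits.ave_add bits.ave_const)
  also have "bits.ave n (\<lambda>x. \<integral>D. measure_pmf.prob I (answer_matches x D) \<partial>\<D>)
    = (\<integral>D. bits.ave n (\<lambda>x. measure_pmf.prob I (answer_matches x D)) \<partial>\<D>)"
    by (simp add: bits.ave_def int Bochner_Integration.integral_sum)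
  also have "\<dots> \<le> 1 / 2 + B / (2 * real n)"
  proof (rule measure_pmf.integral_le_const)
    show "integrable \<D> (\<lambda>D. bits.ave n (\<lambda>x. measure_pmf.prob I (answer_matches x D)))"
      unfolding bits.ave_def by (intro integrable_divide_zero Bochner_Integration.integrable_sum) (simp add: int)
    show "AE D in \<D>. bits.ave n (\<lambda>x. measure_pmf.prob I (answer_matches x D)) \<le> 1 / 2 + B / (2 * real n)"
    proof (rule AE_pmfI)
      fix D assume "D \<in> set_pmf \<D>"
      hence "answer_correlation n d (1 / (2 * c)) D \<le> B"
        using \<D> by (intro B) (simp add: randomized_cell_probe_data_structure_def)
      thus "bits.ave n (\<lambda>x. measure_pmf.prob I (answer_matches x D)) \<le> 1 / 2 + B / (2 * real n)"
        unfolding I_def ave_prob_answer_matches[OF n c] by (simp add: divide_right_mono)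
    qed
  qed
  finally show ?thesis by (simp add: I_def U_def)
qed

section \<open>Asymptotics\<close>

text \<open>The exponent of \<mu> equals \<open>1 + \<zeta> - y / p\<close>, and the part \<zeta>
  cancels against \<open>(\<kappa> * \<mu>) powr (- \<zeta>)\<close>. Since
  \<open>\<mu> powr (- \<tau>\<^sup>2) \<le> \<nu> powr (1 - e)\<close>, the remaining power of
  \<nu> is at most \<open>(1 - e) * (1 + \<zeta>) * \<zeta> - (1 - e / 4) * \<zeta>\<close>; with
  \<open>\<zeta> = e / 2\<close> the loss from the factor \<open>1 + \<zeta>\<close> is smaller than
  the gain from \<kappa>.\<close>

lemma tail_exponent:
  fixes \<tau> \<zeta> \<epsilon> e \<nu> \<mu> :: real
  assumes \<tau>: "0 < \<tau>" "\<tau> < 1" and \<nu>: "1 \<le> \<nu>" and \<epsilon>: "0 < \<epsilon>" "\<epsilon> \<le> 1"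
    and e: "e = \<epsilon> * \<tau>\<^sup>2 / 2" and \<zeta>: "\<zeta> = e / 2"
    and \<mu>: "\<nu> powr (\<epsilon> / 2 - 1 / \<tau>\<^sup>2) \<le> \<mu>" "\<mu> \<le> 1"
  shows "\<mu> powr ((1 + \<zeta>) / (1 + \<tau>\<^sup>2 * \<zeta>)) * (\<nu> powr (1 - e / 4) * \<mu>) powr (- \<zeta>) \<le> \<nu> powr (- (e\<^sup>2 / 8)) * \<mu>"
proof -
  have \<tau>2: "0 < \<tau>\<^sup>2" "\<tau>\<^sup>2 < 1" using \<tau> by (auto simp: abs_square_less_1)
  have e01: "0 < e" "e < 1"
    using \<epsilon> \<tau>2 mult_mono[of \<epsilon> 1 "\<tau>\<^sup>2" 1] by (auto simp: e)
  have \<zeta>0: "0 < \<zeta>" using e01 by (simp add: \<zeta>)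
  have \<mu>0: "0 < \<mu>" using \<mu>(1) \<nu> by (smt (verit) powr_gt_zero)
  define p where "p = 1 + \<tau>\<^sup>2 * \<zeta>"
  define y where "y = (1 + \<zeta>) * \<tau>\<^sup>2 * \<zeta>"
  have p: "1 < p" using \<tau>2 \<zeta>0 by (simp add: p_def)
  have y: "0 \<le> y" using \<tau>2 \<zeta>0 by (simp add: y_def)
  have "(1 + \<zeta>) / p = 1 + \<zeta> - y / p" using p by (simp add: y_def p_def field_simps)
  hence "\<mu> powr ((1 + \<zeta>) / p) = \<mu> powr (1 + \<zeta> + - (y / p))" by simp
  also have "\<dots> = \<mu> * \<mu> powr \<zeta> * \<mu> powr (- (y / p))" using \<mu>0 by (simp only: powr_add powr_one)
  finally have 1: "\<mu> powr ((1 + \<zeta>) / p) = \<mu> * \<mu> powr \<zeta> * \<mu> powr (- (y / p))" .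
  have 2: "(\<nu> powr (1 - e / 4) * \<mu>) powr (- \<zeta>) = \<nu> powr (- ((1 - e / 4) * \<zeta>)) * \<mu> powr (- \<zeta>)"
    by (simp add: powr_mult powr_powr)
  have "\<mu> powr (- (y / p)) \<le> \<mu> powr (- y)"
    using \<mu>0 \<mu>(2) p y by (intro powr_mono') (auto simp: divide_le_eq mult_left_le_one_le intro: mult_left_mono[of 1 p y, simplified])
  also have "\<dots> \<le> (\<nu> powr (\<epsilon> / 2 - 1 / \<tau>\<^sup>2)) powr (- y)"
    using \<mu> \<nu> y by (intro powr_mono2') auto
  also have "\<dots> = \<nu> powr ((1 - e) * (1 + \<zeta>) * \<zeta>)"
  proof -
    have "(\<epsilon> / 2 - 1 / \<tau>\<^sup>2) * \<tau>\<^sup>2 = e - 1" using \<tau>2 by (simp add: e left_diff_distrib)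
    hence "(\<epsilon> / 2 - 1 / \<tau>\<^sup>2) * (- y) = (1 - e) * (1 + \<zeta>) * \<zeta>"
      unfolding y_def by (metis (no_types, opaque_lifting) minus_diff_eq minus_mult_left minus_mult_right mult.assoc mult.left_commute)
    thus ?thesis by (simp only: powr_powr)
  qed
  finally have 3: "\<mu> powr (- (y / p)) \<le> \<nu> powr ((1 - e) * (1 + \<zeta>) * \<zeta>)" .
  have "(1 - e) * (1 + \<zeta>) * \<zeta> - (1 - e / 4) * \<zeta> = - (e\<^sup>2 / 8) - e\<^sup>2 / 2 * \<zeta>"
    by (simp add: \<zeta> power2_eq_square field_simps)
  also have "\<dots> \<le> - (e\<^sup>2 / 8)" using \<zeta>0 by simp
  finally have 4: "(1 - e) * (1 + \<zeta>) * \<zeta> - (1 - e / 4) * \<zeta> \<le> - (e\<^sup>2 / 8)" .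
  have "\<mu> powr ((1 + \<zeta>) / p) * (\<nu> powr (1 - e / 4) * \<mu>) powr (- \<zeta>)
    = \<mu> * \<mu> powr (- (y / p)) * \<nu> powr (- ((1 - e / 4) * \<zeta>))"
    using \<mu>0 unfolding 1 2 by (simp add: powr_minus field_simps)
  also have "\<dots> \<le> \<mu> * \<nu> powr ((1 - e) * (1 + \<zeta>) * \<zeta>) * \<nu> powr (- ((1 - e / 4) * \<zeta>))"
    using \<mu>0 3 by (intro mult_right_mono mult_left_mono) auto
  also have "\<dots> = \<mu> * \<nu> powr ((1 - e) * (1 + \<zeta>) * \<zeta> - (1 - e / 4) * \<zeta>)"
    by (simp add: powr_add[symmetric] mult.assoc)
  also have "\<dots> \<le> \<mu> * \<nu> powr (- (e\<^sup>2 / 8))"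
    using \<mu>0 \<nu> 4 by (intro mult_left_mono powr_mono) auto
  finally show ?thesis by (simp add: p_def mult.commute)
qed

text \<open>
  The four terms stem from the rarely probed cells, the cells probed too often from a single data
  point, the atypical datasets, and the trace bound with the power \<open>2 * k\<close>.
\<close>

definition error_rate :: "real \<Rightarrow> real \<Rightarrow> nat \<Rightarrow> real \<Rightarrow> real" where
  "error_rate \<tau> \<epsilon> k \<nu> = (let e = \<epsilon> * \<tau>\<^sup>2 / 2 in
     4 * \<nu> powr (- (\<epsilon> / 2)) + 2 * \<nu> powr (- (e\<^sup>2 / 8))
     + 4 * \<nu> powr (1 / \<tau>\<^sup>2) * exp (- 2 * \<nu> powr (e / 4))
     + (1 + 4 * (128 * real k) ^ k) * \<nu> powr (- (e / 16)))"

lemma small_table_correlation_le: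
  fixes c \<tau> \<epsilon> :: real
  assumes c: "1 < c" and \<tau>: "\<tau> = (c - 1) / c" and \<epsilon>: "0 < \<epsilon>" "\<epsilon> \<le> 1" and n: "0 < n"
    and h: "16 \<le> 2 ^ h * (\<epsilon> * \<tau>\<^sup>2 * \<tau>\<^sup>2)"
    and m: "real m < real n powr (1 / \<tau>\<^sup>2 - \<epsilon>)"
    and D: "cell_probe_data_structure n d m w 2 D"
  shows "answer_correlation n d (1 / (2 * c)) D \<le> 4 ^ w * (real n * error_rate \<tau> \<epsilon> (2 ^ h) (real n))"
proof (rule answer_correlation_le[OF D])
  fix \<sigma> :: "int list \<Rightarrow> real" and e1 e2 :: "int list \<Rightarrow> bool \<times> nat"
    and Y :: "int list list \<Rightarrow> bool list \<Rightarrow> bool \<times> nat \<Rightarrow> real"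
  assume \<sigma>: "\<And>q. \<bar>\<sigma> q\<bar> \<le> 1" and e1: "\<And>q. q \<in> hamming_cube d \<Longrightarrow> e1 q \<in> UNIV \<times> {..m}"
    and e2: "\<And>q. q \<in> hamming_cube d \<Longrightarrow> e2 q \<in> UNIV \<times> {..m}" and Y: "\<And>P x u. \<bar>Y P x u\<bar> \<le> 1"
  define \<nu> where "\<nu> = real n"
  define V where "V = (UNIV :: bool set) \<times> {..m}"
  define e where "e = \<epsilon> * \<tau>\<^sup>2 / 2"
  define \<zeta> where "\<zeta> = e / 2"
  define \<kappa> where "\<kappa> = \<nu> powr (1 - e / 4)"
  \<comment> \<open>Fewer than \<open>\<nu> powr (1 / \<tau>\<^sup>2 - \<epsilon>)\<close> cells,
    each rarer than \<open>t\<close>, have total frequency at most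
    \<open>\<nu> powr (- (\<epsilon> / 2))\<close>. At frequency \<open>t\<close> the critical
    concentration \<open>t powr (- \<tau>\<^sup>2)\<close> is \<open>\<nu> powr (1 - e)\<close>,
    still below \<kappa>.\<close>
  define t where "t = \<nu> powr (\<epsilon> / 2 - 1 / \<tau>\<^sup>2)"
  define \<eta> where "\<eta> = \<nu> powr (- (e\<^sup>2 / 8))"
  \<comment> \<open>\<open>\<theta>\<^sup>2\<close> exceeds \<open>real n * \<kappa>\<close> by the
    factor \<open>\<nu> powr (e / 8)\<close>, so the base of the moment bound decays, while \<theta>
    itself is below \<nu> by a power.\<close>
  define \<theta> where "\<theta> = \<nu> powr (1 - e / 16)"
  define k :: nat where "k = 2 ^ h"
  have \<nu>: "1 \<le> \<nu>" using n by (simp add: \<nu>_def)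
  have \<tau>01: "0 < \<tau>" "\<tau> < 1" "\<tau> = 1 - 2 * (1 / (2 * c))" using c by (auto simp: \<tau> field_simps)
  have \<tau>2: "0 < \<tau>\<^sup>2" "\<tau>\<^sup>2 < 1" using \<tau>01 by (auto simp: abs_square_less_1)
  have e01: "0 < e" "e < 1"
    using \<epsilon> \<tau>2 mult_mono[of \<epsilon> 1 "\<tau>\<^sup>2" 1] by (auto simp: e_def)
  have cardV: "real (card V) = 2 * (real m + 1)" by (simp add: V_def card_cartesian_product)
  \<comment> \<open>Lets the extra address \<open>m\<close> in \<open>card V = 2 * (m + 1)\<close>
    be absorbed into the constant 4.\<close>
  have "1 \<le> \<nu> powr (1 / \<tau>\<^sup>2 - \<epsilon>)"
  proof (rule ge_one_powr_ge_zero[OF \<nu>])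
    have "\<epsilon> * \<tau>\<^sup>2 \<le> 1 * 1" using \<epsilon> \<tau>2 by (intro mult_mono) auto
    thus "0 \<le> 1 / \<tau>\<^sup>2 - \<epsilon>" using \<tau>2 by (simp add: field_simps)
  qed
  hence V: "real (card V) \<le> 4 * \<nu> powr (1 / \<tau>\<^sup>2 - \<epsilon>)" using m by (simp add: cardV \<nu>_def)
  have V2: "real (card V) \<le> 4 * \<nu> powr (1 / \<tau>\<^sup>2)"
    using V \<epsilon> \<nu> powr_mono[of "1 / \<tau>\<^sup>2 - \<epsilon>" "1 / \<tau>\<^sup>2" \<nu>] by linarith
  have tail: "\<mu> powr ((1 + \<zeta>) / (1 + \<tau>\<^sup>2 * \<zeta>)) * (\<kappa> * \<mu>) powr (- \<zeta>) \<le> \<eta> * \<mu>"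
    if "t \<le> \<mu>" "\<mu> \<le> 1" for \<mu>
    using that unfolding \<kappa>_def \<eta>_def t_def
    by (intro tail_exponent[where \<epsilon> = \<epsilon>] \<tau>01 \<nu> \<epsilon>) (auto simp: e_def \<zeta>_def)
  have "(\<Sum>P\<in>datasets (hamming_cube d) n. bits.ave n (\<lambda>x. \<Sum>i<n. bool_sign (x ! i) *
        (\<Sum>q\<in>hamming_cube d. noise_kernel (1 / (2 * c)) (P ! i) q * \<sigma> q * (Y P x (e1 q) * Y P x (e2 q)))))
      / real (card (hamming_cube d)) ^ n
    \<le> real n * (real (card V) * t + 2 * \<eta>) + real n * (real (card V) * exp (- 2 * real n / \<kappa>))
      + \<theta> * (1 + real (card V) * (4 * (4 * real n) * 2 ^ Suc h * \<kappa> * 2\<^sup>2 / \<theta>\<^sup>2) ^ (2 ^ h))"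
    using e01 \<nu> n e1 e2 \<sigma> Y tail
    by (intro bits.two_query_correlation_le[where \<tau> = \<tau> and \<zeta> = \<zeta>] \<tau>01)
      (auto simp: \<zeta>_def \<kappa>_def t_def \<theta>_def \<eta>_def V_def)
  also have "\<dots> \<le> real n * (4 * \<nu> powr (- (\<epsilon> / 2)) + 2 * \<eta>)
      + real n * (4 * \<nu> powr (1 / \<tau>\<^sup>2) * exp (- 2 * \<nu> powr (e / 4)))
      + \<theta> * (1 + 4 * (128 * real k) ^ k)"
  proof (intro add_mono mult_left_mono order_refl)
    have "real (card V) * t \<le> 4 * \<nu> powr (1 / \<tau>\<^sup>2 - \<epsilon>) * t"
      using V by (intro mult_right_mono) (auto simp: t_def)
    also have "\<dots> = 4 * \<nu> powr (- (\<epsilon> / 2))" by (simp add: t_def powr_add[symmetric])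
    finally show "real (card V) * t \<le> 4 * \<nu> powr (- (\<epsilon> / 2))" .
    have "real n / \<kappa> = \<nu> powr (e / 4)"
    proof -
      have "real n = \<nu> powr 1" using \<nu> by (simp add: \<nu>_def)
      thus ?thesis unfolding \<kappa>_def by (simp only: powr_diff[symmetric]) simp
    qed
    hence "- 2 * real n / \<kappa> = - 2 * \<nu> powr (e / 4)" by simp
    thus "real (card V) * exp (- 2 * real n / \<kappa>) \<le> 4 * \<nu> powr (1 / \<tau>\<^sup>2) * exp (- 2 * \<nu> powr (e / 4))"
      using V2 by (simp only:) (intro mult_right_mono, auto)
    have "4 * (4 * real n) * 2 ^ Suc h * \<kappa> * 2\<^sup>2 / \<theta>\<^sup>2 = 128 * real k * \<nu> powr (- (e / 8))"
    proof -
      have "\<theta>\<^sup>2 = \<nu> powr (2 - e / 8)"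
        by (simp add: \<theta>_def power2_eq_square powr_add[symmetric])
      moreover have "real n * \<kappa> = \<nu> powr (2 - e / 4)"
        using \<nu> by (simp add: \<kappa>_def \<nu>_def powr_mult_base)
      hence "real n * \<kappa> / \<nu> powr (2 - e / 8) = \<nu> powr (- (e / 8))"
        by (simp add: powr_diff[symmetric])
      ultimately have "real n * \<kappa> / \<theta>\<^sup>2 = \<nu> powr (- (e / 8))" by simp
      moreover have "4 * (4 * real n) * 2 ^ Suc h * \<kappa> * 2\<^sup>2 / \<theta>\<^sup>2 = 128 * real k * (real n * \<kappa> / \<theta>\<^sup>2)"
        by (simp add: k_def)
      ultimately show ?thesis by simp
    qed
    hence "(4 * (4 * real n) * 2 ^ Suc h * \<kappa> * 2\<^sup>2 / \<theta>\<^sup>2) ^ (2 ^ h) = (128 * real k) ^ k * \<nu> powr (- (real k * e / 8))"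
      using \<nu> by (simp add: k_def power_mult_distrib powr_power)
    hence "real (card V) * (4 * (4 * real n) * 2 ^ Suc h * \<kappa> * 2\<^sup>2 / \<theta>\<^sup>2) ^ (2 ^ h)
      \<le> 4 * \<nu> powr (1 / \<tau>\<^sup>2) * ((128 * real k) ^ k * \<nu> powr (- (real k * e / 8)))"
      using V2 by (simp only:) (intro mult_right_mono, auto)
    also have "\<dots> = 4 * (128 * real k) ^ k * \<nu> powr (1 / \<tau>\<^sup>2 - real k * e / 8)"
    proof -
      have eq: "\<nu> powr (1 / \<tau>\<^sup>2) * \<nu> powr (- (real k * e / 8)) = \<nu> powr (1 / \<tau>\<^sup>2 - real k * e / 8)"
        by (simp only: powr_add[symmetric] diff_conv_add_uminus)
      have rearrange: "4 * x * (y * z) = 4 * y * (x * z)" for x y z :: real by simp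
      show ?thesis unfolding rearrange[of "\<nu> powr (1 / \<tau>\<^sup>2)"] eq ..
    qed
    also have "\<dots> \<le> 4 * (128 * real k) ^ k * \<nu> powr 0"
    proof -
      \<comment> \<open>The origin of the requirement on \<open>h\<close>: the decay
        \<open>\<nu> powr (- (real k * e / 8))\<close> has to outweigh the number of cells.\<close>
      have "1 \<le> real k * e / 8 * \<tau>\<^sup>2" using h by (simp add: e_def k_def)
      hence "1 / \<tau>\<^sup>2 \<le> real k * e / 8" using \<tau>2 by (simp only: pos_divide_le_eq)
      thus ?thesis using \<nu> by (intro mult_left_mono powr_mono) auto
    qed
    finally show "real (card V) * (4 * (4 * real n) * 2 ^ Suc h * \<kappa> * 2\<^sup>2 / \<theta>\<^sup>2) ^ (2 ^ h) \<le> 4 * (128 * real k) ^ k"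
      using \<nu> by simp
  qed (auto simp: \<theta>_def)
  also have "\<theta> = real n * \<nu> powr (- (e / 16))"
    using \<nu> by (simp add: \<theta>_def \<nu>_def powr_mult_base)
  finally show "(\<Sum>P\<in>datasets (hamming_cube d) n. bits.ave n (\<lambda>x. \<Sum>i<n. bool_sign (x ! i) *
        (\<Sum>q\<in>hamming_cube d. noise_kernel (1 / (2 * c)) (P ! i) q * \<sigma> q * (Y P x (e1 q) * Y P x (e2 q)))))
      / real (card (hamming_cube d)) ^ n
    \<le> real n * error_rate \<tau> \<epsilon> (2 ^ h) (real n)"
    by (simp only: error_rate_def Let_def e_def[symmetric] \<nu>_def[symmetric] \<eta>_def[symmetric] k_def[symmetric])
      (simp add: algebra_simps)
qed

text \<open>The spare power of n absorbs the factor \<open>4 ^ w\<close>; its exponent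
  \<open>e\<^sup>2 / 16\<close> lies below the decay exponents \<open>\<epsilon> / 2\<close>,
  \<open>e\<^sup>2 / 8\<close> and \<open>e / 16\<close>.\<close>

lemma error_rate_tendsto_0:
  fixes \<tau> \<epsilon> :: real
  assumes \<tau>: "0 < \<tau>" "\<tau> < 1" and \<epsilon>: "0 < \<epsilon>" "\<epsilon> \<le> 1"
  shows "(\<lambda>n. real n powr ((\<epsilon> * \<tau>\<^sup>2 / 2)\<^sup>2 / 16) * error_rate \<tau> \<epsilon> k (real n)) \<longlonglongrightarrow> 0"
proof -
  define e where "e = \<epsilon> * \<tau>\<^sup>2 / 2"
  define \<xi> where "\<xi> = e\<^sup>2 / 16"
  have \<tau>2: "0 < \<tau>\<^sup>2" "\<tau>\<^sup>2 < 1" using \<tau> by (auto simp: abs_square_less_1)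
  have "\<epsilon> * \<tau>\<^sup>2 < \<epsilon> * 1" using \<epsilon> \<tau>2 by (intro mult_strict_left_mono) auto
  hence e: "0 < e" "e < \<epsilon> / 2" using \<epsilon> \<tau>2 by (auto simp: e_def)
  hence "e < 1" using \<epsilon> by linarith
  have "e * e < e * 1" using e \<open>e < 1\<close> by (intro mult_strict_left_mono) auto
  hence e2: "0 < e\<^sup>2" "e\<^sup>2 < e" using e by (auto simp: power2_eq_square)
  have \<xi>: "\<xi> < \<epsilon> / 2" "\<xi> < e\<^sup>2 / 8" "\<xi> < e / 16"
    using e2 e unfolding \<xi>_def by (auto simp del: zero_less_power2)
  have neg: "(\<lambda>n. real n powr \<xi> * real n powr (- b)) \<longlonglongrightarrow> 0" if "\<xi> < b" for b
    using that by real_asymp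
  have ex: "(\<lambda>n. real n powr (\<xi> + 1 / \<tau>\<^sup>2) * exp (- 2 * real n powr (e / 4))) \<longlonglongrightarrow> 0"
    using e(1) by real_asymp
  have "(\<lambda>n. 4 * (real n powr \<xi> * real n powr (- (\<epsilon> / 2))) + 2 * (real n powr \<xi> * real n powr (- (e\<^sup>2 / 8)))
     + 4 * (real n powr (\<xi> + 1 / \<tau>\<^sup>2) * exp (- 2 * real n powr (e / 4)))
     + (1 + 4 * (128 * real k) ^ k) * (real n powr \<xi> * real n powr (- (e / 16))))
    \<longlonglongrightarrow> 4 * 0 + 2 * 0 + 4 * 0 + (1 + 4 * (128 * real k) ^ k) * 0"
    by (intro tendsto_add tendsto_mult tendsto_const neg \<xi> ex)
  thus ?thesis
    by (simp only: error_rate_def Let_def e_def[symmetric] \<xi>_def[symmetric])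
      (simp add: powr_add algebra_simps)
qed

section \<open>A fixed loss in the exponent, then a vanishing one\<close>

lemma space_lower_bound:
  fixes c \<epsilon> :: real and d w :: "nat \<Rightarrow> nat" and r c' :: "nat \<Rightarrow> real"
  assumes c: "c > 1" and \<epsilon>: "0 < \<epsilon>" "\<epsilon> \<le> 1"
    and w: "(\<lambda>n. real (w n)) \<in> o(\<lambda>n. ln (real n))"
    and promise: "(\<lambda>n. measure_pmf.prob (hamming_random_instance c n (d n))
            {(P, i, q). unique_near_neighbour (r n) (c' n) P q i}) \<longlonglongrightarrow> 1"
  shows "\<forall>\<^sub>F n in sequentially. \<forall>m \<D>.
       randomized_cell_probe_data_structure n (d n) m (w n) 2 \<D> \<and>
       solves_decision_ann_on_random_instance c (r n) (c' n) n (d n) (2 / 3) \<D> \<longrightarrow>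
       real m \<ge> real n powr ((c / (c - 1))\<^sup>2 - \<epsilon>)"
proof -
  define \<tau> where "\<tau> = (c - 1) / c"
  define \<xi> where "\<xi> = (\<epsilon> * \<tau>\<^sup>2 / 2)\<^sup>2 / 16"
  have \<tau>: "0 < \<tau>" "\<tau> < 1" using c by (auto simp: \<tau>_def)
  have \<rho>: "(c / (c - 1))\<^sup>2 = 1 / \<tau>\<^sup>2" by (simp add: \<tau>_def power_divide)
  have \<xi>: "0 < \<xi>" using \<tau> \<epsilon> by (simp add: \<xi>_def)
  have "0 < \<epsilon> * \<tau>\<^sup>2 * \<tau>\<^sup>2" using \<tau> \<epsilon> by simp
  moreover obtain h where "16 / (\<epsilon> * \<tau>\<^sup>2 * \<tau>\<^sup>2) < 2 ^ h"
    using real_arch_pow[of 2 "16 / (\<epsilon> * \<tau>\<^sup>2 * \<tau>\<^sup>2)"] by auto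
  ultimately have h: "16 \<le> 2 ^ h * (\<epsilon> * \<tau>\<^sup>2 * \<tau>\<^sup>2)" by (simp add: divide_less_eq)
  have "\<forall>\<^sub>F n in sequentially. norm (real (w n)) \<le> \<xi> / ln 4 * norm (ln (real n))"
    using \<xi> by (intro landau_o.smallD[OF w]) simp
  hence ev_w: "\<forall>\<^sub>F n in sequentially. 4 ^ w n \<le> real n powr \<xi>"
    using eventually_gt_at_top[of 0]
  proof eventually_elim
    case (elim n)
    hence "real (w n) * ln 4 \<le> \<xi> * ln (real n)" by (simp add: field_simps)
    hence "exp (real (w n) * ln 4) \<le> exp (\<xi> * ln (real n))" by simp
    also have "exp (real (w n) * ln 4) = 4 ^ w n" by (simp add: exp_of_nat_mult)
    also have "exp (\<xi> * ln (real n)) = real n powr \<xi>" using elim by (simp add: powr_def)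
    finally show ?case .
  qed
  \<comment> \<open>The advantage is halved to less than 1 / 12 and the promise fails with
    probability less than 1 / 24; together they stay below the gap 1 / 6 between 1 / 2 and 2 /
    3.\<close>
  have ev_err: "\<forall>\<^sub>F n in sequentially. real n powr \<xi> * error_rate \<tau> \<epsilon> (2 ^ h) (real n) < 1 / 6"
    using order_tendstoD(2)[OF error_rate_tendsto_0[OF \<tau> \<epsilon>, of "2 ^ h"], of "1 / 6"] by (simp add: \<xi>_def)
  have ev_promise: "\<forall>\<^sub>F n in sequentially. 23 / 24 < measure_pmf.prob (hamming_random_instance c n (d n))
            {(P, i, q). unique_near_neighbour (r n) (c' n) P q i}"
    using order_tendstoD(1)[OF promise, of "23 / 24"] by simp
  show ?thesis
    using ev_w ev_err ev_promise eventually_gt_at_top[of 0]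
  proof eventually_elim
    case (elim n)
    define S where "S = error_rate \<tau> \<epsilon> (2 ^ h) (real n)"
    have S: "0 \<le> S" by (simp add: S_def error_rate_def Let_def)
    show ?case
    proof (intro allI impI, elim conjE, rule ccontr)
      fix m \<D>
      assume \<D>: "randomized_cell_probe_data_structure n (d n) m (w n) 2 \<D>"
        and solves: "solves_decision_ann_on_random_instance c (r n) (c' n) n (d n) (2 / 3) \<D>"
        and "\<not> real n powr ((c / (c - 1))\<^sup>2 - \<epsilon>) \<le> real m"
      hence m: "real m < real n powr (1 / \<tau>\<^sup>2 - \<epsilon>)" by (simp add: \<rho>)
      have "2 / 3 \<le> 1 / 2 + 4 ^ w n * (real n * S) / (2 * real n)
        + (1 - measure_pmf.prob (hamming_random_instance c n (d n)) {(P, i, q). unique_near_neighbour (r n) (c' n) P q i})"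
        unfolding S_def
        by (rule success_probability_le[OF elim(4) c \<D> solves])
          (rule small_table_correlation_le[OF c \<tau>_def \<epsilon> elim(4) h m])
      also have "4 ^ w n * (real n * S) / (2 * real n) = 4 ^ w n * S / 2" using elim(4) by simp
      also have "4 ^ w n * S \<le> real n powr \<xi> * S" using elim(1) S by (intro mult_right_mono)
      finally show False using elim(2,3) unfolding S_def by linarith
    qed
  qed
qed

text \<open>Diagonal choice: \<open>K n\<close> is the largest \<open>k \<le> n\<close> whose loss
  \<open>1 / (k + 1)\<close> is already valid at \<open>n\<close>. It tends to infinity because each
  fixed \<open>k\<close> is eventually admissible.\<close>

lemma eventually_vanishing_error:
  fixes Q :: "nat \<Rightarrow> real \<Rightarrow> bool"
  assumes "\<And>k. \<forall>\<^sub>F n in sequentially. Q n (1 / real (Suc k))"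
  shows "\<exists>\<epsilon>. \<epsilon> \<longlonglongrightarrow> 0 \<and> (\<forall>\<^sub>F n in sequentially. Q n (\<epsilon> n))"
proof -
  define A where "A n = {k. k \<le> n \<and> Q n (1 / real (Suc k))}" for n
  \<comment> \<open>Inserting 0 gives \<open>Max\<close> a value where \<open>A n\<close> is empty,
    which happens only for finitely many \<open>n\<close>.\<close>
  define K where "K n = Max (insert 0 (A n))" for n
  have fin: "finite (A n)" for n by (simp add: A_def)
  have lim: "filterlim K at_top sequentially"
  proof (rule filterlim_at_top[THEN iffD2], rule allI)
    fix k
    show "\<forall>\<^sub>F n in sequentially. k \<le> K n"
      using assms[of k] eventually_ge_at_top[of k]
      by eventually_elim (simp add: K_def A_def fin[unfolded A_def])
  qed
  have "\<forall>\<^sub>F n in sequentially. Q n (1 / real (Suc (K n)))"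
    using assms[of 0]
  proof eventually_elim
    case (elim n)
    hence "0 \<in> A n" by (simp add: A_def)
    hence "K n \<in> A n" using Max_in[OF fin, of n] by (auto simp: K_def insert_absorb)
    thus ?case by (simp add: A_def)
  qed
  moreover have "(\<lambda>n. 1 / real (Suc (K n))) \<longlonglongrightarrow> 0"
    by (rule filterlim_compose[OF _ lim]) (use LIMSEQ_inverse_real_of_nat in \<open>simp add: inverse_eq_divide\<close>)
  ultimately show ?thesis by blast
qed

theorem theorem3:
  fixes c :: real and d w :: "nat \<Rightarrow> nat" and r c' :: "nat \<Rightarrow> real"
  assumes "c > 1"
    and "(\<lambda>n. ln (real n)) \<in> o(\<lambda>n. real (d n))"
    and "(\<lambda>n. real (w n)) \<in> o(\<lambda>n. ln (real n))"
    and "r \<sim>[at_top] (\<lambda>n. real (d n) / (2 * c))"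
    and "c' \<longlonglongrightarrow> c"
    and "(\<lambda>n. measure_pmf.prob (hamming_random_instance c n (d n))
            {(P, i, q). unique_near_neighbour (r n) (c' n) P q i}) \<longlonglongrightarrow> 1"
  shows "\<exists>\<epsilon> :: nat \<Rightarrow> real. \<epsilon> \<longlonglongrightarrow> 0 \<and>
    (\<forall>\<^sub>F n in sequentially. \<forall>m \<D>.
       randomized_cell_probe_data_structure n (d n) m (w n) 2 \<D> \<and>
       solves_decision_ann_on_random_instance c (r n) (c' n) n (d n) (2 / 3) \<D> \<longrightarrow>
       real m \<ge> real n powr ((c / (c - 1))\<^sup>2 - \<epsilon> n))"
  by (rule eventually_vanishing_error, rule space_lower_bound) (use assms in auto)

end
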